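(* There exists a (deterministic) fully dynamic graph algorithm which maintains a maximal matching of an undirected graph on $n$ vertices, using a lookahead of length $m$, with amortized update cost $O(\log m)$, with constant (that is, $O(1)$) query cost for queries of the form $\mathrm{mate}(u)$, and with setup cost $O(n^2\cdot\log m)$. Here $m$ denotes the maximum number of edges of the graph during its life cycle.
   Context: Graphs are finite and undirected, on a fixed set of $n$ vertices, and are viewed as sets (or lists) of edges; $|G|$ is the number of edges of $G$. A matching of $G$ is a set $M\subseteq G$ of edges with pairwise disjoint sets of endpoints; it is maximal if there is no matching $M'\supsetneq M$ of $G$. Fully dynamic maximal matching problem: the graph is initially empty and undergoes a (possibly arbitrarily long) stream $q_1,q_2,\ldots,q_t$ of updates, each update being either the insertion $+(u,v)$ of one edge or the deletion $-(u,v)$ of one edge. For a graph $G$, $Gq_1\cdots q_i$ denotes the graph obtained from $G$ by applying the updates $q_1,\ldots,q_i$ in order. With $G$ the initial graph, $m:=\max\{|Gq_1q_2\cdots q_i| : 0\le i\le t\}$. After handling each update the algorithm must have a maximal matching $M$ of the current graph. Between the handling of updates, queries $\mathrm{mate}(u)$ may be asked; the answer is the unique vertex $v$ with $(u,v)\in M$ if such a vertex exists, and $\textsc{null}$ otherwise, where $M$ is the current maximal matching. Lookahead of length $m$: at any moment the algorithm may inspect the next $m$ not yet processed operations of the stream. The setup cost is the cost of a one-time initialization at the start of the program, and is not counted in the update cost. The amortized update cost is the total time spent on handling the updates divided by the number of updates. Array entries (indexed by vertices or by pairs of vertices) can be accessed in constant time. *)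

theory Defs
  imports Complex_Main
begin

section \<open>Graphs, matchings and update streams\<close>

text \<open>The vertices are \<open>0, \<dots>, n - 1\<close>; an undirected edge is a two-element set of vertices.\<close>

type_synonym vertex = nat
type_synonym edge = "vertex set"
type_synonym graph = "edge set"

definition is_matching :: "graph \<Rightarrow> graph \<Rightarrow> bool" where
  "is_matching G M \<longleftrightarrow> M \<subseteq> G \<and> (\<forall>e\<in>M. \<forall>f\<in>M. e \<noteq> f \<longrightarrow> e \<inter> f = {})"

definition maximal_matching :: "graph \<Rightarrow> graph \<Rightarrow> bool" where
  "maximal_matching G M \<longleftrightarrow> is_matching G M \<and> \<not> (\<exists>M'. is_matching G M' \<and> M \<subset> M')"

definition mate :: "graph \<Rightarrow> vertex \<Rightarrow> vertex option" where
  "mate M u = (if \<exists>v. {u, v} \<in> M then Some (THE v. {u, v} \<in> M) else None)"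

datatype update = Insert vertex vertex | Delete vertex vertex

fun valid_update :: "nat \<Rightarrow> update \<Rightarrow> bool" where
  "valid_update n (Insert u v) \<longleftrightarrow> u < n \<and> v < n \<and> u \<noteq> v"
| "valid_update n (Delete u v) \<longleftrightarrow> u < n \<and> v < n \<and> u \<noteq> v"

text \<open>Graphs being sets, inserting a present edge or deleting an absent one has no effect.\<close>

fun apply_update :: "update \<Rightarrow> graph \<Rightarrow> graph" where
  "apply_update (Insert u v) G = insert {u, v} G"
| "apply_update (Delete u v) G = G - {{u, v}}"

definition graph_after :: "update list \<Rightarrow> graph" where
  "graph_after qs = fold apply_update qs {}"

definition max_edges :: "update list \<Rightarrow> nat" where
  "max_edges qs = Max ((\<lambda>i. card (graph_after (take i qs))) ` {..length qs})"


section \<open>A word RAM with a lookahead window\<close>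

text \<open>
  Programs are closed syntactic objects over named registers and arrays. An array cell is
  accessed in constant time, and every expression node and command executed is charged one unit.
  A stored value or a written cell address that does not lie below the bound \<open>W\<close> blocks the
  execution, so that a program cannot pack large amounts of data into single numbers.

  The window \<open>w\<close> is the visible part of the stream of not yet processed updates.
  \<open>LookKind\<close> reads 0 beyond its end, 1 for an insertion and 2 for a deletion.
\<close>

datatype binop = Add | Sub | Mul | Div | Mod | Less | Eq

datatype exp =
    Const nat
  | Reg string
  | Cell string exp
  | Op binop exp exp
  | LookKind exp
  | LookFst exp
  | LookSnd exp

datatype com =
    Skip
  | Assign string exp
  | Store string exp exp
  | Seq com com
  | If exp com com
  | While exp com

record state =
  reg :: "string \<Rightarrow> nat"
  arr :: "string \<Rightarrow> nat \<Rightarrow> nat"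

fun eval_op :: "binop \<Rightarrow> nat \<Rightarrow> nat \<Rightarrow> nat" where
  "eval_op Add x y = x + y"
| "eval_op Sub x y = x - y"
| "eval_op Mul x y = x * y"
| "eval_op Div x y = x div y"
| "eval_op Mod x y = x mod y"
| "eval_op Less x y = (if x < y then 1 else 0)"
| "eval_op Eq x y = (if x = y then 1 else 0)"

fun kind_of :: "update \<Rightarrow> nat" where
  "kind_of (Insert u v) = 1"
| "kind_of (Delete u v) = 2"

fun fst_of :: "update \<Rightarrow> vertex" where
  "fst_of (Insert u v) = u"
| "fst_of (Delete u v) = u"

fun snd_of :: "update \<Rightarrow> vertex" where
  "snd_of (Insert u v) = v"
| "snd_of (Delete u v) = v"

definition look :: "(update \<Rightarrow> nat) \<Rightarrow> update list \<Rightarrow> nat \<Rightarrow> nat" where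
  "look f w j = (if j < length w then f (w ! j) else 0)"

primrec eval :: "update list \<Rightarrow> state \<Rightarrow> exp \<Rightarrow> nat" where
  "eval w s (Const c) = c"
| "eval w s (Reg x) = reg s x"
| "eval w s (Cell a e) = arr s a (eval w s e)"
| "eval w s (Op f e1 e2) = eval_op f (eval w s e1) (eval w s e2)"
| "eval w s (LookKind e) = look kind_of w (eval w s e)"
| "eval w s (LookFst e) = look fst_of w (eval w s e)"
| "eval w s (LookSnd e) = look snd_of w (eval w s e)"

primrec exp_cost :: "exp \<Rightarrow> nat" where
  "exp_cost (Const c) = 1"
| "exp_cost (Reg x) = 1"
| "exp_cost (Cell a e) = 1 + exp_cost e"
| "exp_cost (Op f e1 e2) = 1 + exp_cost e1 + exp_cost e2"
| "exp_cost (LookKind e) = 1 + exp_cost e"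
| "exp_cost (LookFst e) = 1 + exp_cost e"
| "exp_cost (LookSnd e) = 1 + exp_cost e"

definition set_reg :: "string \<Rightarrow> nat \<Rightarrow> state \<Rightarrow> state" where
  "set_reg x v s = s\<lparr>reg := (reg s)(x := v)\<rparr>"

definition set_cell :: "string \<Rightarrow> nat \<Rightarrow> nat \<Rightarrow> state \<Rightarrow> state" where
  "set_cell a i v s = s\<lparr>arr := (arr s)(a := (arr s a)(i := v))\<rparr>"

text \<open>\<open>exec W w c s k s'\<close>: started in \<open>s\<close>, the program \<open>c\<close> terminates in \<open>s'\<close> after \<open>k\<close> time units.\<close>

inductive exec :: "nat \<Rightarrow> update list \<Rightarrow> com \<Rightarrow> state \<Rightarrow> nat \<Rightarrow> state \<Rightarrow> bool"
  for W :: nat and w :: "update list"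
where
  Skip: "exec W w Skip s 1 s"
| Assign: "eval w s e < W \<Longrightarrow>
    exec W w (Assign x e) s (1 + exp_cost e) (set_reg x (eval w s e) s)"
| Store: "eval w s i < W \<Longrightarrow> eval w s e < W \<Longrightarrow>
    exec W w (Store a i e) s (1 + exp_cost i + exp_cost e) (set_cell a (eval w s i) (eval w s e) s)"
| Seq: "exec W w c1 s k1 s' \<Longrightarrow> exec W w c2 s' k2 s'' \<Longrightarrow>
    exec W w (Seq c1 c2) s (1 + k1 + k2) s''"
| IfTrue: "eval w s b \<noteq> 0 \<Longrightarrow> exec W w c1 s k s' \<Longrightarrow>
    exec W w (If b c1 c2) s (1 + exp_cost b + k) s'"
| IfFalse: "eval w s b = 0 \<Longrightarrow> exec W w c2 s k s' \<Longrightarrow>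
    exec W w (If b c1 c2) s (1 + exp_cost b + k) s'"
| WhileFalse: "eval w s b = 0 \<Longrightarrow>
    exec W w (While b c) s (1 + exp_cost b) s"
| WhileTrue: "eval w s b \<noteq> 0 \<Longrightarrow> exec W w c s k1 s' \<Longrightarrow> exec W w (While b c) s' k2 s'' \<Longrightarrow>
    exec W w (While b c) s (1 + exp_cost b + k1 + k2) s''"

inductive_cases SkipE: "exec W w Skip s k s'"
inductive_cases AssignE: "exec W w (Assign x e) s k s'"
inductive_cases StoreE: "exec W w (Store a i e) s k s'"
inductive_cases SeqE: "exec W w (Seq c1 c2) s k s'"
inductive_cases IfE: "exec W w (If b c1 c2) s k s'"
inductive_cases WhileE: "exec W w (While b c) s k s'"

lemma exec_deterministic:
  "exec W w c s k s' \<Longrightarrow> exec W w c s l t' \<Longrightarrow> l = k \<and> t' = s'"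
proof (induction arbitrary: l t' rule: exec.induct)
  case (Skip s)
  then show ?case by (auto elim: SkipE)
next
  case (Assign s e x)
  then show ?case by (auto elim: AssignE)
next
  case (Store s i e a)
  then show ?case by (auto elim: StoreE)
next
  case (Seq c1 s k1 s' c2 k2 s'')
  from Seq.prems obtain l1 l2 t where
    "exec W w c1 s l1 t" "exec W w c2 t l2 t'" "l = 1 + l1 + l2"
    by (auto elim: SeqE)
  with Seq.IH(1)[of l1 t] Seq.IH(2)[of l2 t'] show ?case by simp
next
  case (IfTrue s b c1 k s' c2)
  from IfTrue.prems IfTrue.hyps(1) obtain l1 where
    "exec W w c1 s l1 t'" "l = 1 + exp_cost b + l1"
    by (auto elim: IfE)
  with IfTrue.IH[of l1 t'] show ?case by simp
next
  case (IfFalse s b c2 k s' c1)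
  from IfFalse.prems IfFalse.hyps(1) obtain l1 where
    "exec W w c2 s l1 t'" "l = 1 + exp_cost b + l1"
    by (auto elim: IfE)
  with IfFalse.IH[of l1 t'] show ?case by simp
next
  case (WhileFalse s b c)
  from WhileFalse.prems WhileFalse.hyps show ?case by (auto elim: WhileE)
next
  case (WhileTrue s b c k1 s' k2 s'')
  from WhileTrue.prems WhileTrue.hyps(1) obtain l1 l2 t where
    "exec W w c s l1 t" "exec W w (While b c) t l2 t'" "l = 1 + exp_cost b + l1 + l2"
    by (auto elim: WhileE)
  with WhileTrue.IH(1)[of l1 t] WhileTrue.IH(2)[of l2 t'] show ?case by simp
qed

text \<open>Words of \<open>O(log n)\<close> bits.\<close>

definition word_bound :: "nat \<Rightarrow> nat \<Rightarrow> nat" where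
  "word_bound k n = (n + 2) ^ k"

definition within_words :: "nat \<Rightarrow> state \<Rightarrow> bool" where
  "within_words W s \<longleftrightarrow> (\<forall>x. reg s x < W) \<and> (\<forall>a i. arr s a i < W)"


section \<open>Dynamic algorithms with lookahead\<close>

record algorithm =
  init_prog :: com
  update_prog :: com
  query_prog :: com

datatype event = Update update | Mate vertex

fun is_update :: "event \<Rightarrow> bool" where
  "is_update (Update q) = True"
| "is_update (Mate u) = False"

fun updates :: "event list \<Rightarrow> update list" where
  "updates [] = []"
| "updates (Update q # es) = q # updates es"
| "updates (Mate u # es) = updates es"

text \<open>
  The initialization finds \<open>n\<close> and \<open>m\<close> in registers, arbitrary words everywhere else (clearing
  memory is part of its cost), and sees no part of the stream.
\<close>

definition run_init :: "nat \<Rightarrow> algorithm \<Rightarrow> nat \<Rightarrow> nat \<Rightarrow> state \<Rightarrow> nat \<Rightarrow> state \<Rightarrow> bool" where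
  "run_init W A n m s k s' \<longleftrightarrow>
     exec W [] (init_prog A) (set_reg ''n'' n (set_reg ''m'' m s)) k s'"

text \<open>
  \<open>run_events W A m s es tr\<close>: from state \<open>s\<close>, the algorithm serves the events \<open>es\<close> one after the
  other; \<open>tr\<close> records each event with the time spent on it and the state reached. While an update
  is being handled it still counts as not processed, so it is the first of the \<open>m\<close> visible
  operations.
\<close>

inductive run_events ::
  "nat \<Rightarrow> algorithm \<Rightarrow> nat \<Rightarrow> state \<Rightarrow> event list \<Rightarrow> (event \<times> nat \<times> state) list \<Rightarrow> bool"
  for W :: nat and A :: algorithm and m :: nat
where
  Done: "run_events W A m s [] []"
| Update: "exec W (take m (q # updates es)) (update_prog A) s k s' \<Longrightarrow>
    run_events W A m s' es tr \<Longrightarrow>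
    run_events W A m s (Update q # es) ((Update q, k, s') # tr)"
| Mate: "exec W (take m (updates es)) (query_prog A) (set_reg ''u'' u s) k s' \<Longrightarrow>
    run_events W A m s' es tr \<Longrightarrow>
    run_events W A m s (Mate u # es) ((Mate u, k, s') # tr)"

lemma run_events_deterministic:
  "run_events W A m s es tr \<Longrightarrow> run_events W A m s es tr' \<Longrightarrow> tr' = tr"
proof (induction arbitrary: tr' rule: run_events.induct)
  case (Done s)
  then show ?case by cases
next
  case (Update q es s k s' tr)
  from Update.prems obtain l t us where
    "exec W (take m (q # updates es)) (update_prog A) s l t" "run_events W A m t es us"
    "tr' = (event.Update q, l, t) # us"
    by cases
  with exec_deterministic[OF Update.hyps(1)] Update.IH[of us] show ?case by simp
next
  case (Mate es u s k s' tr)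
  from Mate.prems obtain l t us where
    "exec W (take m (updates es)) (query_prog A) (set_reg ''u'' u s) l t" "run_events W A m t es us"
    "tr' = (event.Mate u, l, t) # us"
    by cases
  with exec_deterministic[OF Mate.hyps(1)] Mate.IH[of us] show ?case by simp
qed

text \<open>The answer to a query; every value that is not a vertex encodes null.\<close>

definition answer :: "nat \<Rightarrow> state \<Rightarrow> vertex option" where
  "answer n s = (if reg s ''mate'' < n then Some (reg s ''mate'') else None)"

definition amortized_update_cost :: "(event \<times> nat \<times> state) list \<Rightarrow> real" where
  "amortized_update_cost tr =
     (let us = filter (\<lambda>(e, k, s). is_update e) tr
      in real (\<Sum>(e, k, s)\<leftarrow>us. k) / real (length us))"

text \<open>\<open>M i\<close> is the matching held after the first \<open>i\<close> updates, whatever has been queried so far.\<close>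

definition queries_ok ::
  "nat \<Rightarrow> (nat \<Rightarrow> graph) \<Rightarrow> real \<Rightarrow> (event \<times> nat \<times> state) list \<Rightarrow> bool" where
  "queries_ok n M C tr \<longleftrightarrow>
     (\<forall>j < length tr. \<forall>u k s. tr ! j = (Mate u, k, s) \<longrightarrow>
        answer n s = mate (M (length (updates (map fst (take j tr))))) u \<and> real k \<le> C)"

text \<open>The factor \<open>log m\<close>, read as 1 where the logarithm would be below 1.\<close>

definition log_factor :: "nat \<Rightarrow> real" where
  "log_factor m = max 1 (log 2 (real m))"

end

theory Submission
  imports Defs
begin

text \<open>
  The updates are served in batches of length \<open>2^L\<close> with \<open>2^L \<le> m < 2^(L+1)\<close>. At position \<open>p\<close> of
  a batch, for every \<open>l \<le> L\<close> the part of the matching outside the edges touched in the aligned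
  block of length \<open>2^l\<close> containing \<open>p\<close> is maximal outside these edges; such a statement survives all
  updates of the block. When \<open>2^j\<close> is the largest block length dividing \<open>p\<close>, only the levels up to
  \<open>j\<close> have to be renewed: the edges touched in the surrounding block of length \<open>2^(j+1)\<close> (all edges,
  if \<open>p = 0\<close>) are unmatched and matched again greedily. An edge that is touched later than another
  one has to be tried first, so that it cannot be blocked by an edge of a smaller block; this is why
  the edges not touched in the coming \<open>2^j\<close> updates come first, followed by the others in
  decreasing order of their next occurrence. Renewing costs \<open>O(2^j)\<close>, and \<open>2^j\<close> divides only every
  \<open>2^j\<close>-th time, so every one of the \<open>L + 1\<close> levels costs \<open>O(1)\<close> per update.
\<close>

section \<open>Executing programs\<close>

text \<open>The batch length is dictated from both sides (for m > 0): \<open>2^L <= m\<close> lets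
  the window show a whole batch at its first update, and \<open>m < 2^(L+1)\<close> makes the O(m)
  rebuilding of the edge list at a batch start an O(2^L) cost, charged to the top level. The list
  \<open>Q\<close> holds the at most m edges present at the batch start, then the edges of the
  coming 2^L updates; so every edge occurring during the batch is on it, and blocks of updates are
  intervals of positions. "Maximal outside Y" is made precise by \<open>covers\<close>: every edge
  outside Y has an endpoint matched by an edge outside Y, so neither changing the graph inside Y nor
  unmatching edges of Y can spoil it. Trying edges by decreasing next occurrence yields this for all
  prefixes of the coming 2^j updates in one pass: the prefixes of length 2^l are the blocks of the
  levels l <= j, and the empty prefix gives plain maximality. As m is at most the number of updates,
  an incomplete last batch costs only a constant factor. The matchings must be fixed before the
  queries are known, so one query-free sequence of states is built and shown to underlie every
  interleaving.\<close>

lemma reg_set_reg [simp]: "reg (set_reg x v s) = (reg s)(x := v)"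
  by (simp add: set_reg_def)

lemma arr_set_reg [simp]: "arr (set_reg x v s) = arr s"
  by (simp add: set_reg_def)

lemma reg_set_cell [simp]: "reg (set_cell a i v s) = reg s"
  by (simp add: set_cell_def)

lemma arr_set_cell [simp]: "arr (set_cell a i v s) = (arr s)(a := (arr s a)(i := v))"
  by (simp add: set_cell_def)

text \<open>Symbolic execution of loop-free code, so that loop bodies are handled by the simplifier.
  The values given to \<open>While\<close> here and in \<open>max_cost\<close> are dummies, since
  \<open>safe\<close> rejects every loop that would be reached.\<close>

primrec step :: "update list \<Rightarrow> com \<Rightarrow> state \<Rightarrow> state" where
  "step w Skip s = s"
| "step w (Assign x e) s = set_reg x (eval w s e) s"
| "step w (Store a i e) s = set_cell a (eval w s i) (eval w s e) s"
| "step w (Seq c1 c2) s = step w c2 (step w c1 s)"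
| "step w (If b c1 c2) s = (if eval w s b \<noteq> 0 then step w c1 s else step w c2 s)"
| "step w (While b c) s = s"

primrec safe :: "nat \<Rightarrow> update list \<Rightarrow> com \<Rightarrow> state \<Rightarrow> bool" where
  "safe W w Skip s \<longleftrightarrow> True"
| "safe W w (Assign x e) s \<longleftrightarrow> eval w s e < W"
| "safe W w (Store a i e) s \<longleftrightarrow> eval w s i < W \<and> eval w s e < W"
| "safe W w (Seq c1 c2) s \<longleftrightarrow> safe W w c1 s \<and> safe W w c2 (step w c1 s)"
| "safe W w (If b c1 c2) s \<longleftrightarrow> (if eval w s b \<noteq> 0 then safe W w c1 s else safe W w c2 s)"
| "safe W w (While b c) s \<longleftrightarrow> False"

primrec max_cost :: "com \<Rightarrow> nat" where
  "max_cost Skip = 1"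
| "max_cost (Assign x e) = 1 + exp_cost e"
| "max_cost (Store a i e) = 1 + exp_cost i + exp_cost e"
| "max_cost (Seq c1 c2) = 1 + max_cost c1 + max_cost c2"
| "max_cost (If b c1 c2) = 1 + exp_cost b + max (max_cost c1) (max_cost c2)"
| "max_cost (While b c) = 0"

lemma exec_step:
  "safe W w c s \<Longrightarrow> \<exists>k. exec W w c s k (step w c s) \<and> k \<le> max_cost c"
proof (induction c arbitrary: s)
  case Skip
  show ?case using exec.Skip[of W w s] by (intro exI[of _ 1]) simp
next
  case (Assign x e)
  then show ?case using exec.Assign[of w s e W x] by (intro exI[of _ "1 + exp_cost e"]) simp
next
  case (Store a i e)
  then show ?case using exec.Store[of w s i W e a]
    by (intro exI[of _ "1 + exp_cost i + exp_cost e"]) simp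
next
  case (Seq c1 c2)
  then obtain k1 k2 where "exec W w c1 s k1 (step w c1 s)" "k1 \<le> max_cost c1"
    "exec W w c2 (step w c1 s) k2 (step w c2 (step w c1 s))" "k2 \<le> max_cost c2"
    by fastforce
  then show ?case using exec.Seq by (intro exI[of _ "1 + k1 + k2"]) fastforce
next
  case (If b c1 c2)
  show ?case
  proof (cases "eval w s b = 0")
    case True
    with If obtain k where "exec W w c2 s k (step w c2 s)" "k \<le> max_cost c2" by fastforce
    with True show ?thesis using exec.IfFalse by (intro exI[of _ "1 + exp_cost b + k"]) fastforce
  next
    case False
    with If obtain k where "exec W w c1 s k (step w c1 s)" "k \<le> max_cost c1" by fastforce
    with False show ?thesis using exec.IfTrue by (intro exI[of _ "1 + exp_cost b + k"]) fastforce
  qed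
next
  case (While b c)
  then show ?case by simp
qed

primrec written_regs :: "com \<Rightarrow> string set" where
  "written_regs Skip = {}"
| "written_regs (Assign x e) = {x}"
| "written_regs (Store a i e) = {}"
| "written_regs (Seq c1 c2) = written_regs c1 \<union> written_regs c2"
| "written_regs (If b c1 c2) = written_regs c1 \<union> written_regs c2"
| "written_regs (While b c) = written_regs c"

primrec written_arrs :: "com \<Rightarrow> string set" where
  "written_arrs Skip = {}"
| "written_arrs (Assign x e) = {}"
| "written_arrs (Store a i e) = {a}"
| "written_arrs (Seq c1 c2) = written_arrs c1 \<union> written_arrs c2"
| "written_arrs (If b c1 c2) = written_arrs c1 \<union> written_arrs c2"
| "written_arrs (While b c) = written_arrs c"

text \<open>A purely syntactic frame: loop invariants then have to mention only what the body
  writes.\<close>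

definition frame :: "com \<Rightarrow> state \<Rightarrow> state \<Rightarrow> bool" where
  "frame c s s' \<longleftrightarrow> (\<forall>x. x \<notin> written_regs c \<longrightarrow> reg s' x = reg s x) \<and>
     (\<forall>a. a \<notin> written_arrs c \<longrightarrow> arr s' a = arr s a)"

lemma exec_frame: "exec W w c s k s' \<Longrightarrow> frame c s s'"
  by (induction rule: exec.induct) (auto simp: frame_def)

lemma frameD:
  assumes "frame c s s'"
  shows "x \<notin> written_regs c \<Longrightarrow> reg s' x = reg s x"
    and "a \<notin> written_arrs c \<Longrightarrow> arr s' a = arr s a"
  using assms by (auto simp: frame_def)

text \<open>Total correctness with a known number \<open>N\<close> of iterations: the invariant is
  indexed by the iterations already done, so the time bound comes out of the same induction. The
  frame always refers back to the state before the loop.\<close>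

lemma exec_While:
  assumes "I 0 s"
    and body: "\<And>i s'. i < N \<Longrightarrow> frame c s s' \<Longrightarrow> I i s' \<Longrightarrow>
      eval w s' b \<noteq> 0 \<and> (\<exists>k s''. exec W w c s' k s'' \<and> k \<le> B \<and> I (Suc i) s'')"
    and exit: "\<And>s'. frame c s s' \<Longrightarrow> I N s' \<Longrightarrow> eval w s' b = 0"
  shows "\<exists>k s'. exec W w (While b c) s k s' \<and> k \<le> (N + 1) * (1 + exp_cost b + B) \<and>
    I N s' \<and> frame c s s'"
proof -
  have "i \<le> N \<Longrightarrow> frame c s s' \<Longrightarrow> I i s' \<Longrightarrow>
    \<exists>k s''. exec W w (While b c) s' k s'' \<and> k \<le> (N - i + 1) * (1 + exp_cost b + B) \<and>
      I N s'' \<and> frame c s s''" for i s'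
  proof (induction "N - i" arbitrary: i s')
    case 0
    then have "i = N" by simp
    with 0 exit[of s'] exec.WhileFalse[of w s' b W c] show ?case
      by (intro exI[of _ "1 + exp_cost b"] exI[of _ s']) auto
  next
    case (Suc d)
    then have "i < N" by simp
    from body[OF this Suc.prems(2,3)] obtain k s1 where
      b: "eval w s' b \<noteq> 0" and k: "exec W w c s' k s1" "k \<le> B" and I: "I (Suc i) s1"
      by blast
    from exec_frame[OF k(1)] Suc.prems(2) have "frame c s s1"
      by (auto simp: frame_def)
    with Suc.hyps I \<open>i < N\<close> obtain l s2 where
      l: "exec W w (While b c) s1 l s2" "l \<le> (N - Suc i + 1) * (1 + exp_cost b + B)"
      and "I N s2" "frame c s s2"
      using Suc.hyps(1)[of "Suc i" s1] by (metis Suc_diff_Suc Suc_leI diff_Suc_1')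
    moreover have "exec W w (While b c) s' (1 + exp_cost b + k + l) s2"
      by (rule exec.WhileTrue[OF b k(1) l(1)])
    moreover have "1 + exp_cost b + k + l \<le> (N - i + 1) * (1 + exp_cost b + B)"
    proof -
      have "N - i + 1 = Suc (N - Suc i + 1)" using \<open>i < N\<close> by simp
      then show ?thesis using k(2) l(2) by simp
    qed
    ultimately show ?case by blast
  qed
  from this[of 0 s] assms(1) show ?thesis by (auto simp: frame_def)
qed

lemma exec_While_step:
  assumes "I 0 s"
    and "\<And>i s'. i < N \<Longrightarrow> frame c s s' \<Longrightarrow> I i s' \<Longrightarrow>
      eval w s' b \<noteq> 0 \<and> safe W w c s' \<and> I (Suc i) (step w c s')"
    and "\<And>s'. frame c s s' \<Longrightarrow> I N s' \<Longrightarrow> eval w s' b = 0"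
  shows "\<exists>k s'. exec W w (While b c) s k s' \<and> k \<le> (N + 1) * (1 + exp_cost b + max_cost c) \<and>
    I N s' \<and> frame c s s'"
proof (rule exec_While[of I, OF assms(1) _ assms(3)])
  fix i s' assume "i < N" "frame c s s'" "I i s'"
  from assms(2)[OF this] exec_step[of W w c s']
  show "eval w s' b \<noteq> 0 \<and>
      (\<exists>k s''. exec W w c s' k s'' \<and> k \<le> max_cost c \<and> I (Suc i) s'')"
    by blast
qed

section \<open>Edge codes and matchings\<close>

text \<open>Ordering the endpoints gives every edge a single code. Equal endpoints yield 0, the code
  of the loop at vertex 0, which serves as padding for positions beyond the end of the
  stream.\<close>

definition code :: "nat \<Rightarrow> nat \<Rightarrow> nat \<Rightarrow> nat" where
  "code n u v = (if u < v then u * n + v else if v < u then v * n + u else 0)"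

definition decode :: "nat \<Rightarrow> nat \<Rightarrow> edge" where
  "decode n e = {e div n, e mod n}"

definition canonical :: "nat \<Rightarrow> nat \<Rightarrow> bool" where
  "canonical n e \<longleftrightarrow> e < n * n \<and> e div n \<le> e mod n"

lemma canonical_lt: "canonical n e \<Longrightarrow> e div n < n \<and> e mod n < n"
  by (metis canonical_def less_mult_imp_div_less gr_zeroI mod_less_divisor mult_0 not_less_zero)

lemma canonical_code: "u < n \<Longrightarrow> v < n \<Longrightarrow> canonical n (code n u v)"
proof -
  have *: "a < n \<Longrightarrow> b < n \<Longrightarrow> a * n + b < n * n" for a b
  proof -
    assume "a < n" "b < n"
    then have "a * n + b < Suc a * n" by simp
    also have "\<dots> \<le> n * n" using \<open>a < n\<close> by (intro mult_right_mono) auto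
    finally show ?thesis .
  qed
  assume "u < n" "v < n"
  then show ?thesis
    using *[of u v] *[of v u] by (auto simp: canonical_def code_def)
qed

lemma canonical_0: "n > 0 \<Longrightarrow> canonical n 0"
  by (simp add: canonical_def)

lemma decode_code: "u < n \<Longrightarrow> v < n \<Longrightarrow> u \<noteq> v \<Longrightarrow> decode n (code n u v) = {u, v}"
  by (auto simp: decode_def code_def)

lemma decode_inj:
  assumes "canonical n e" "canonical n f" "decode n e = decode n f"
  shows "e = f"
proof -
  have "e div n = f div n \<and> e mod n = f mod n"
    using assms unfolding canonical_def decode_def doubleton_eq_iff by auto
  then show ?thesis by (metis div_mult_mod_eq)
qed

definition simple_graph :: "nat \<Rightarrow> graph \<Rightarrow> bool" where
  "simple_graph n G \<longleftrightarrow> (\<forall>e\<in>G. \<exists>u v. e = {u, v} \<and> u < n \<and> v < n \<and> u \<noteq> v)"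

lemma simple_graphE:
  assumes "e \<in> G" "simple_graph n G"
  obtains u v where "e = {u, v}" "u \<noteq> v" "u < n" "v < n"
  using assms by (auto simp: simple_graph_def)

text \<open>A matching is stored as the function sending a vertex to its mate, and to \<open>n\<close> if it has none.\<close>

definition mates :: "nat \<Rightarrow> graph \<Rightarrow> (nat \<Rightarrow> nat) \<Rightarrow> bool" where
  "mates n G f \<longleftrightarrow> (\<forall>u<n. f u \<le> n \<and>
     (f u < n \<longrightarrow> f u \<noteq> u \<and> f (f u) = u \<and> {u, f u} \<in> G))"

definition edges_of :: "nat \<Rightarrow> (nat \<Rightarrow> nat) \<Rightarrow> graph" where
  "edges_of n f = {{u, f u} |u. u < n \<and> f u < n}"

text \<open>The matched edges outside \<open>Y\<close> form a maximal matching of the graph without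
  \<open>Y\<close>. Requiring the blocking edge itself to lie outside \<open>Y\<close> is what makes
  the property independent of everything that happens inside \<open>Y\<close>; for empty
  \<open>Y\<close> it is ordinary maximality.\<close>

definition covers :: "nat \<Rightarrow> graph \<Rightarrow> (nat \<Rightarrow> nat) \<Rightarrow> edge set \<Rightarrow> bool" where
  "covers n G f Y \<longleftrightarrow> (\<forall>e\<in>G. e \<notin> Y \<longrightarrow> (\<exists>u\<in>e. f u < n \<and> {u, f u} \<notin> Y))"

lemma matesD:
  assumes "mates n G f" "u < n"
  shows "f u \<le> n" and "f u < n \<Longrightarrow> f u \<noteq> u \<and> f (f u) = u \<and> {u, f u} \<in> G"
  using assms unfolding mates_def by blast+

lemma mates_disjoint:
  assumes "mates n G f" "e \<in> edges_of n f" "e' \<in> edges_of n f" "e \<noteq> e'"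
  shows "e \<inter> e' = {}"
proof -
  have "e'' = {x, f x}" if "e'' \<in> edges_of n f" "x \<in> e''" for e'' x
  proof -
    from that(1) obtain u where u: "e'' = {u, f u}" "u < n" "f u < n"
      by (auto simp: edges_of_def)
    then have "f (f u) = u" using matesD[OF assms(1)] by blast
    then show ?thesis using that(2) u(1) by (cases "x = u") (simp_all add: insert_commute)
  qed
  from this[OF assms(2)] this[OF assms(3)] assms(4) show ?thesis
    by (metis disjoint_iff)
qed

lemma maximal_matching_edges_of:
  assumes "simple_graph n G" "mates n G f" "covers n G f {}"
  shows "maximal_matching G (edges_of n f)"
proof -
  have sub: "edges_of n f \<subseteq> G" using assms(2) by (auto simp: edges_of_def mates_def)
  then have "is_matching G (edges_of n f)"
    using mates_disjoint[OF assms(2)] by (auto simp: is_matching_def)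
  moreover have False if M': "is_matching G M'" "edges_of n f \<subset> M'" for M'
  proof -
    from M'(2) obtain e where e: "e \<in> M'" "e \<notin> edges_of n f" by blast
    with M'(1) have "e \<in> G" by (auto simp: is_matching_def)
    with assms(3) obtain u where u: "u \<in> e" "f u < n" by (auto simp: covers_def)
    obtain a b where "e = {a, b}" "a < n" "b < n"
      using \<open>e \<in> G\<close> assms(1) by (auto simp: simple_graph_def)
    then have "u < n" using u(1) by auto
    with u have f: "{u, f u} \<in> edges_of n f" by (auto simp: edges_of_def)
    with M'(2) have "{u, f u} \<in> M'" by blast
    with e f M'(1) have "e \<inter> {u, f u} = {}" unfolding is_matching_def by metis
    with u show False by auto
  qed
  ultimately show ?thesis by (auto simp: maximal_matching_def)
qed

lemma mate_edges_of:
  assumes "mates n G f" "u < n"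
  shows "mate (edges_of n f) u = (if f u < n then Some (f u) else None)"
proof -
  have *: "{u, v} \<in> edges_of n f \<longleftrightarrow> f u < n \<and> v = f u" for v
  proof
    assume "{u, v} \<in> edges_of n f"
    then obtain x where x: "{u, v} = {x, f x}" "x < n" "f x < n" by (auto simp: edges_of_def)
    then have "f (f x) = x" using matesD[OF assms(1)] by blast
    with x show "f u < n \<and> v = f u" by (auto simp: doubleton_eq_iff)
  next
    assume "f u < n \<and> v = f u"
    with assms(2) show "{u, v} \<in> edges_of n f" by (auto simp: edges_of_def)
  qed
  then show ?thesis by (auto simp: mate_def)
qed

lemma mates_match:
  assumes "mates n G f" "{u, v} \<in> G" "u < n" "v < n" "u \<noteq> v" "f u = n" "f v = n"
  shows "mates n G (f(u := v, v := u))"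
  unfolding mates_def
proof (intro allI impI)
  fix x assume x: "x < n"
  let ?g = "f(u := v, v := u)"
  show "?g x \<le> n \<and> (?g x < n \<longrightarrow> ?g x \<noteq> x \<and> ?g (?g x) = x \<and> {x, ?g x} \<in> G)"
  proof (cases "x \<in> {u, v}")
    case True
    have "{v, u} \<in> G" using assms(2) by (simp add: insert_commute)
    with True assms(2-5) show ?thesis by auto
  next
    case False
    have "f x \<notin> {u, v}" if "f x < n"
    proof
      assume "f x \<in> {u, v}"
      then have "f (f x) = n" using assms(6,7) by auto
      moreover have "f (f x) = x" using matesD[OF assms(1) x] that by blast
      ultimately show False using x by simp
    qed
    with False matesD[OF assms(1) x] show ?thesis by auto
  qed
qed

lemma covers_extend:
  assumes "covers n G f Y" "\<And>u. f u < n \<Longrightarrow> f' u = f u"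
  shows "covers n G f' Y"
  unfolding covers_def
proof (intro ballI impI)
  fix e assume "e \<in> G" "e \<notin> Y"
  with assms(1) obtain u where "u \<in> e" "f u < n" "{u, f u} \<notin> Y"
    unfolding covers_def by blast
  then show "\<exists>u\<in>e. f' u < n \<and> {u, f' u} \<notin> Y"
    using assms(2) by (intro bexI[of _ u]) simp_all
qed

text \<open>One iteration of the unmatching loop, with \<open>T\<close> the edges already treated.
  Testing one endpoint is enough: \<open>g u = v\<close> holds exactly if the edge is matched and
  has not been removed by an earlier occurrence.\<close>

lemma mates_remove_step:
  assumes f: "mates n G f" and u: "u < n" "v < n"
    and g: "\<And>x. x < n \<Longrightarrow> g x = (if f x < n \<and> {x, f x} \<in> T then n else f x)"
    and x: "x < n"
  shows "(if g u = v then g(u := n, v := n) else g) x =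
    (if f x < n \<and> {x, f x} \<in> insert {u, v} T then n else f x)"
proof -
  have *: "f y < n \<Longrightarrow> f (f y) = y \<and> f y \<noteq> y" if "y < n" for y
    using matesD[OF f] that by blast
  show ?thesis
  proof (cases "x \<in> {u, v}")
    case False
    then show ?thesis using g[OF x] by (auto simp: doubleton_eq_iff)
  next
    case x': True
    show ?thesis
    proof (cases "f u = v")
      case True
      then have fv: "f v = u" using *[OF u(1)] u by simp
      show ?thesis
      proof (cases "{u, v} \<in> T")
        case True
        then have "{v, u} \<in> T" by (simp add: insert_commute)
        with True \<open>f u = v\<close> fv g[OF u(1)] g[OF u(2)] x' u show ?thesis by auto
      next
        case False
        then have "{v, u} \<notin> T" by (simp add: insert_commute)
        with False \<open>f u = v\<close> fv g[OF u(1)] g[OF u(2)] x' u show ?thesis by (auto simp: insert_commute)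
      qed
    next
      case False
      then have fv: "f v \<noteq> u" using *[OF u(2)] u by auto
      have "g u \<noteq> v" using g[OF u(1)] False u by auto
      with False fv g[OF x] x' show ?thesis by (auto simp: doubleton_eq_iff)
    qed
  qed
qed

section \<open>The loops of the algorithm\<close>

definition extends :: "nat \<Rightarrow> (nat \<Rightarrow> nat) \<Rightarrow> (nat \<Rightarrow> nat) \<Rightarrow> bool" where
  "extends n f g \<longleftrightarrow> (\<forall>u. f u < n \<longrightarrow> g u = f u)"

text \<open>As long as no edge of \<open>Y\<close> is matched, any matched endpoint is already a
  witness for \<open>covers\<close> with respect to \<open>Y\<close>.\<close>

definition avoids :: "nat \<Rightarrow> (nat \<Rightarrow> nat) \<Rightarrow> edge set \<Rightarrow> bool" where
  "avoids n f Y \<longleftrightarrow> (\<forall>u<n. f u < n \<longrightarrow> {u, f u} \<notin> Y)"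

definition represents :: "nat \<Rightarrow> graph \<Rightarrow> (nat \<Rightarrow> nat) \<Rightarrow> bool" where
  "represents n G pr \<longleftrightarrow> (\<forall>e. canonical n e \<longrightarrow> pr e = (if decode n e \<in> G then 1 else 0))"

definition match_at :: "nat \<Rightarrow> (nat \<Rightarrow> nat) \<Rightarrow> nat \<Rightarrow> (nat \<Rightarrow> nat) \<Rightarrow> nat \<Rightarrow> nat" where
  "match_at n pr e f =
     (if pr e \<noteq> 0 \<and> f (e div n) = n \<and> f (e mod n) = n
      then f(e div n := e mod n, e mod n := e div n) else f)"

definition first_end :: exp where
  "first_end = Op Div (Reg ''e'') (Reg ''n'')"

definition second_end :: exp where
  "second_end = Op Mod (Reg ''e'') (Reg ''n'')"

definition advance :: com where
  "advance = Assign ''i'' (Op Add (Reg ''i'') (Const 1))"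

definition retreat :: com where
  "retreat = Assign ''i'' (Op Sub (Reg ''i'') (Const 1))"

definition fetch :: com where
  "fetch = Assign ''e'' (Cell ''Q'' (Reg ''i''))"

definition unmatch_prog :: com where
  "unmatch_prog = Seq fetch (Seq (Store ''mk'' (Reg ''e'') (Const 0))
     (Seq (If (Op Eq (Cell ''mt'' first_end) second_end)
        (Seq (Store ''mt'' first_end (Reg ''n'')) (Store ''mt'' second_end (Reg ''n''))) Skip)
      advance))"

text \<open>Running downwards and overwriting, the loop leaves in each mark the first occurrence of
  the edge. The position is stored plus 1, so that 0 can mean "not touched in the coming
  updates".\<close>

definition mark_prog :: com where
  "mark_prog = Seq retreat (Store ''mk'' (Cell ''Q'' (Reg ''i'')) (Op Add (Reg ''i'') (Const 1)))"

definition match_prog :: com where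
  "match_prog =
     If (Op Mul (Cell ''P'' (Reg ''e'')) (Op Mul (Op Eq (Cell ''mt'' first_end) (Reg ''n''))
          (Op Eq (Cell ''mt'' second_end) (Reg ''n''))))
       (Seq (Store ''mt'' first_end second_end) (Store ''mt'' second_end first_end)) Skip"

definition match_unmarked_prog :: com where
  "match_unmarked_prog = Seq fetch (Seq
     (If (Op Eq (Cell ''mk'' (Reg ''e'')) (Const 0)) match_prog Skip) advance)"

text \<open>An edge occurring several times is tried only where the mark agrees with the position,
  that is at its first occurrence, the last one visited. This realizes the order by decreasing next
  occurrence without sorting.\<close>

definition match_marked_prog :: com where
  "match_marked_prog = Seq retreat (Seq fetch
     (If (Op Eq (Cell ''mk'' (Reg ''e'')) (Op Add (Reg ''i'') (Const 1))) match_prog Skip))"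

lemmas prog_defs = first_end_def second_end_def advance_def retreat_def fetch_def

text \<open>A trial either matches the edge or finds an endpoint already taken, so a present edge
  has a matched endpoint afterwards. Edges already matched stay, which gives
  \<open>extends\<close>.\<close>

lemma match_at:
  assumes f: "mates n G f" and e: "canonical n e" and pr: "represents n G pr"
    and G: "simple_graph n G" and Y: "avoids n f Y" "decode n e \<notin> Y"
  shows "mates n G (match_at n pr e f)" "extends n f (match_at n pr e f)"
    "avoids n (match_at n pr e f) Y"
    "decode n e \<in> G \<Longrightarrow> \<exists>u\<in>decode n e. match_at n pr e f u < n"
proof -
  let ?u = "e div n" and ?v = "e mod n"
  have uv: "?u < n" "?v < n" using canonical_lt[OF e] by auto
  have pre: "pr e = (if decode n e \<in> G then 1 else 0)" using pr e by (simp add: represents_def)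
  show "extends n f (match_at n pr e f)" by (auto simp: extends_def match_at_def)
  show "mates n G (match_at n pr e f)"
  proof (cases "pr e \<noteq> 0 \<and> f ?u = n \<and> f ?v = n")
    case True
    with pre have "{?u, ?v} \<in> G" by (auto simp: decode_def split: if_splits)
    \<comment> \<open>Simplicity of \<open>G\<close> supplies the distinct endpoints; a code of a
      loop, such as the padding, can never be matched.\<close>
    moreover from this G obtain a b where "{?u, ?v} = {a, b}" "a \<noteq> b"
      by (rule simple_graphE)
    then have "?u \<noteq> ?v" by (auto simp: doubleton_eq_iff)
    ultimately show ?thesis using mates_match[OF f] uv True by (simp add: match_at_def)
  next
    case False
    then show ?thesis using f by (auto simp: match_at_def)
  qed
  show "avoids n (match_at n pr e f) Y"
    unfolding avoids_def
  proof (intro allI impI)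
    fix x assume x: "x < n" "match_at n pr e f x < n"
    have d: "{?u, ?v} \<notin> Y" "{?v, ?u} \<notin> Y"
      using Y(2) by (simp_all add: decode_def insert_commute)
    have "f x < n \<Longrightarrow> {x, f x} \<notin> Y" using Y(1) x(1) by (simp add: avoids_def)
    with d x(2) show "{x, match_at n pr e f x} \<notin> Y"
      unfolding match_at_def by (auto split: if_splits)
  qed
  assume "decode n e \<in> G"
  with pre have "pr e = 1" by simp
  moreover have "f ?u \<le> n" "f ?v \<le> n" using matesD(1)[OF f] uv by auto
  ultimately show "\<exists>u\<in>decode n e. match_at n pr e f u < n"
    using uv by (auto simp: match_at_def decode_def)
qed

lemma avoids_subset:
  assumes "avoids n f Y" "Z \<subseteq> Y" shows "avoids n f Z"
  using assms by (auto simp: avoids_def)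

lemma extends_trans: "extends n f g \<Longrightarrow> extends n g h \<Longrightarrow> extends n f h"
  by (auto simp: extends_def)

lemma covers_extends: "covers n G f Y \<Longrightarrow> extends n f g \<Longrightarrow> covers n G g Y"
  using covers_extend[of n G f Y g] by (simp add: extends_def)

text \<open>The marks are reset in the same pass, because earlier rounds and the arbitrary initial
  memory leave values behind. In this and the following loop lemmas 60 is a common bound for one
  guard evaluation plus one body.\<close>

lemma exec_unmatch:
  fixes s :: state
  defines "Q \<equiv> arr s ''Q''" and "f \<equiv> arr s ''mt''"
  assumes n: "reg s ''n'' = n" "n * n < W" "n < W"
    and i: "reg s ''i'' = lo" "reg s ''hi'' = hi" "lo \<le> hi" "hi < W"
    and Q: "\<And>j. lo \<le> j \<Longrightarrow> j < hi \<Longrightarrow> canonical n (Q j)"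
    and f: "mates n G f"
  shows "\<exists>k s'. exec W w (While (Op Less (Reg ''i'') (Reg ''hi'')) unmatch_prog) s k s' \<and>
    k \<le> (hi - lo + 1) * 60 \<and>
    ((\<forall>u<n. arr s' ''mt'' u = (if f u < n \<and> {u, f u} \<in> decode n ` Q ` {lo..<hi} then n else f u)) \<and>
     (\<forall>j. lo \<le> j \<longrightarrow> j < hi \<longrightarrow> arr s' ''mk'' (Q j) = 0)) \<and>
    frame unmatch_prog s s'"
proof -
  define I where "I = (\<lambda>j (s' :: state). reg s' ''i'' = lo + j \<and>
    (\<forall>u<n. arr s' ''mt'' u =
      (if f u < n \<and> {u, f u} \<in> decode n ` Q ` {lo..<lo + j} then n else f u)) \<and>
    (\<forall>j'. lo \<le> j' \<longrightarrow> j' < lo + j \<longrightarrow> arr s' ''mk'' (Q j') = 0))"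
  have "\<exists>k s'. exec W w (While (Op Less (Reg ''i'') (Reg ''hi'')) unmatch_prog) s k s' \<and>
      k \<le> (hi - lo + 1) * (1 + exp_cost (Op Less (Reg ''i'') (Reg ''hi'')) + max_cost unmatch_prog) \<and>
      I (hi - lo) s' \<and> frame unmatch_prog s s'"
  proof (rule exec_While_step)
    show "I 0 s" using i by (simp add: I_def f_def)
  next
    fix j s' assume j: "j < hi - lo" and fr: "frame unmatch_prog s s'" and I: "I j s'"
    let ?e = "Q (lo + j)"
    have s': "reg s' ''n'' = n" "reg s' ''hi'' = hi" "arr s' ''Q'' = Q" "reg s' ''i'' = lo + j"
      using frameD[OF fr] I n i by (simp_all add: unmatch_prog_def prog_defs Q_def I_def)
    have e: "canonical n ?e" using Q j by simp
    have uv: "?e div n < n" "?e mod n < n" using canonical_lt[OF e] by auto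
    have eW: "?e < W" "?e div n < W" "?e mod n < W" using e uv n by (simp_all add: canonical_def)
    have g: "\<And>x. x < n \<Longrightarrow> arr s' ''mt'' x =
        (if f x < n \<and> {x, f x} \<in> decode n ` Q ` {lo..<lo + j} then n else f x)"
      using I by (simp add: I_def)
    have ins: "decode n ` Q ` {lo..<lo + Suc j} =
        insert {?e div n, ?e mod n} (decode n ` Q ` {lo..<lo + j})"
      by (simp add: atLeastLessThanSuc decode_def)
    have mt: "arr (step w unmatch_prog s') ''mt'' =
        (if arr s' ''mt'' (?e div n) = ?e mod n
         then (arr s' ''mt'')(?e div n := n, ?e mod n := n) else arr s' ''mt'')"
      using s' by (simp add: unmatch_prog_def prog_defs)
    have "\<forall>u<n. arr (step w unmatch_prog s') ''mt'' u =
      (if f u < n \<and> {u, f u} \<in> decode n ` Q ` {lo..<lo + Suc j} then n else f u)"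
      unfolding mt ins using mates_remove_step[OF f uv g] by blast
    moreover have "arr (step w unmatch_prog s') ''mk'' = (arr s' ''mk'')(?e := 0)"
      "reg (step w unmatch_prog s') ''i'' = lo + Suc j"
      using s' by (simp_all add: unmatch_prog_def prog_defs)
    ultimately have "I (Suc j) (step w unmatch_prog s')"
      using I by (auto simp: I_def less_Suc_eq)
    moreover have "safe W w unmatch_prog s'"
      using s' eW n i j by (simp add: unmatch_prog_def prog_defs)
    ultimately show "eval w s' (Op Less (Reg ''i'') (Reg ''hi'')) \<noteq> 0 \<and> safe W w unmatch_prog s' \<and>
      I (Suc j) (step w unmatch_prog s')"
      using s' j by simp
  next
    fix s' assume fr: "frame unmatch_prog s s'" and I: "I (hi - lo) s'"
    then show "eval w s' (Op Less (Reg ''i'') (Reg ''hi'')) = 0"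
      using i frameD[OF fr] by (simp add: I_def unmatch_prog_def prog_defs)
  qed
  then obtain k s' where "exec W w (While (Op Less (Reg ''i'') (Reg ''hi'')) unmatch_prog) s k s'"
    "k \<le> (hi - lo + 1) * (1 + exp_cost (Op Less (Reg ''i'') (Reg ''hi'')) + max_cost unmatch_prog)"
    "I (hi - lo) s'" "frame unmatch_prog s s'" by blast
  moreover from this(2) have "k \<le> (hi - lo + 1) * 60"
    by (rule order_trans[OF _ mult_left_mono]) (simp_all add: unmatch_prog_def prog_defs)
  ultimately show ?thesis using i(3) unfolding I_def by (intro exI[of _ k] exI[of _ s']) simp
qed

lemma exec_mark:
  fixes s :: state
  defines "Q \<equiv> arr s ''Q''"
  assumes i: "reg s ''i'' = b" "reg s ''a'' = a" "a \<le> b" "b < W"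
    and Q: "\<And>j. a \<le> j \<Longrightarrow> j < b \<Longrightarrow> Q j < W"
  shows "\<exists>k s'. exec W w (While (Op Less (Reg ''a'') (Reg ''i'')) mark_prog) s k s' \<and>
    k \<le> (b - a + 1) * 60 \<and>
    ((\<forall>e. e \<notin> Q ` {a..<b} \<longrightarrow> arr s' ''mk'' e = arr s ''mk'' e) \<and>
     (\<forall>j. a \<le> j \<longrightarrow> j < b \<longrightarrow> arr s' ''mk'' (Q j) \<noteq> 0 \<and>
       (arr s' ''mk'' (Q j) = Suc j \<longleftrightarrow> Q j \<notin> Q ` {a..<j}))) \<and>
    frame mark_prog s s'"
proof -
  define I where "I = (\<lambda>k (s' :: state). reg s' ''i'' = b - k \<and>
    (\<forall>e. e \<notin> Q ` {b - k..<b} \<longrightarrow> arr s' ''mk'' e = arr s ''mk'' e) \<and>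
    (\<forall>j. b - k \<le> j \<longrightarrow> j < b \<longrightarrow> arr s' ''mk'' (Q j) \<noteq> 0 \<and>
       (arr s' ''mk'' (Q j) = Suc j \<longleftrightarrow> Q j \<notin> Q ` {b - k..<j})))"
  have "\<exists>k s'. exec W w (While (Op Less (Reg ''a'') (Reg ''i'')) mark_prog) s k s' \<and>
      k \<le> (b - a + 1) * (1 + exp_cost (Op Less (Reg ''a'') (Reg ''i'')) + max_cost mark_prog) \<and>
      I (b - a) s' \<and> frame mark_prog s s'"
  proof (rule exec_While_step)
    show "I 0 s" using i by (simp add: I_def)
  next
    fix k s' assume k: "k < b - a" and fr: "frame mark_prog s s'" and I: "I k s'"
    define c where "c = b - Suc k"
    have c: "b - k = Suc c" "a \<le> c" "c < b" using k by (auto simp: c_def)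
    have s': "reg s' ''a'' = a" "arr s' ''Q'' = Q" "reg s' ''i'' = Suc c"
      using frameD[OF fr] I i c by (simp_all add: mark_prog_def prog_defs Q_def I_def)
    have mk: "arr (step w mark_prog s') ''mk'' = (arr s' ''mk'')(Q c := Suc c)"
      and ri: "reg (step w mark_prog s') ''i'' = c"
      using s' by (simp_all add: mark_prog_def prog_defs)
    have ivl: "{c..<j} = insert c {Suc c..<j}" if "c < j" for j using that by auto
    have "I (Suc k) (step w mark_prog s')"
      unfolding I_def c_def[symmetric]
    proof (intro conjI allI impI)
      show "reg (step w mark_prog s') ''i'' = c" by (rule ri)
    next
      fix e assume "e \<notin> Q ` {c..<b}"
      then show "arr (step w mark_prog s') ''mk'' e = arr s ''mk'' e"
        using I c by (auto simp: I_def mk ivl)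
    next
      fix j assume j: "c \<le> j" "j < b"
      then show "arr (step w mark_prog s') ''mk'' (Q j) \<noteq> 0"
        using I c unfolding I_def mk c(1) by (cases "j = c") auto
      show "(arr (step w mark_prog s') ''mk'' (Q j) = Suc j) = (Q j \<notin> Q ` {c..<j})"
        using I c j unfolding I_def mk c(1) by (cases "j = c") (auto simp: ivl)
    qed
    moreover have "safe W w mark_prog s'"
      using s' c i Q[of c] by (simp add: mark_prog_def prog_defs)
    ultimately show "eval w s' (Op Less (Reg ''a'') (Reg ''i'')) \<noteq> 0 \<and> safe W w mark_prog s' \<and>
      I (Suc k) (step w mark_prog s')"
      using s' c by simp
  next
    fix s' assume fr: "frame mark_prog s s'" and I: "I (b - a) s'"
    then show "eval w s' (Op Less (Reg ''a'') (Reg ''i'')) = 0"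
      using i frameD[OF fr] by (simp add: I_def mark_prog_def prog_defs)
  qed
  then obtain k s' where "exec W w (While (Op Less (Reg ''a'') (Reg ''i'')) mark_prog) s k s'"
    "k \<le> (b - a + 1) * (1 + exp_cost (Op Less (Reg ''a'') (Reg ''i'')) + max_cost mark_prog)"
    "I (b - a) s'" "frame mark_prog s s'" by blast
  moreover from this(2) have "k \<le> (b - a + 1) * 60"
    by (rule order_trans[OF _ mult_left_mono]) (simp_all add: mark_prog_def prog_defs)
  ultimately show ?thesis using i(3) unfolding I_def by (intro exI[of _ k] exI[of _ s']) simp
qed

lemma step_match_prog:
  assumes "reg s ''n'' = n" "reg s ''e'' = e"
  shows "step w match_prog s = s\<lparr>arr := (arr s)(''mt'' := match_at n (arr s ''P'') e (arr s ''mt''))\<rparr>"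
  using assms by (auto simp: match_prog_def prog_defs match_at_def set_cell_def)

lemma safe_match_prog:
  assumes "reg s ''n'' = n" "reg s ''e'' = e" "canonical n e" "n < W"
  shows "safe W w match_prog s"
  using assms canonical_lt[OF assms(3)] by (auto simp: match_prog_def prog_defs)

text \<open>Here \<open>Y\<close> will be the set of edges touched in the coming 2^j updates. The
  marks are not written in this loop, so membership in \<open>Y\<close> can be tested throughout,
  and no edge of \<open>Y\<close> is matched.\<close>

lemma exec_match_unmarked:
  fixes s :: state
  defines "Q \<equiv> arr s ''Q''" and "f \<equiv> arr s ''mt''"
  assumes n: "reg s ''n'' = n" "n * n < W" "n < W"
    and i: "reg s ''i'' = lo" "reg s ''hi'' = hi" "lo \<le> hi" "hi < W"
    and Q: "\<And>j. lo \<le> j \<Longrightarrow> j < hi \<Longrightarrow> canonical n (Q j)"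
    and f: "mates n G f" "simple_graph n G" "represents n G (arr s ''P'')" "avoids n f Y"
    and mk: "\<And>j. lo \<le> j \<Longrightarrow> j < hi \<Longrightarrow> arr s ''mk'' (Q j) = 0 \<longleftrightarrow> decode n (Q j) \<notin> Y"
  shows "\<exists>k s'. exec W w (While (Op Less (Reg ''i'') (Reg ''hi'')) match_unmarked_prog) s k s' \<and>
    k \<le> (hi - lo + 1) * 60 \<and>
    (mates n G (arr s' ''mt'') \<and> extends n f (arr s' ''mt'') \<and> avoids n (arr s' ''mt'') Y \<and>
     (\<forall>j. lo \<le> j \<longrightarrow> j < hi \<longrightarrow> decode n (Q j) \<in> G \<longrightarrow> decode n (Q j) \<notin> Y \<longrightarrow>
        (\<exists>u\<in>decode n (Q j). arr s' ''mt'' u < n))) \<and>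
    frame match_unmarked_prog s s'"
proof -
  define I where "I = (\<lambda>k (s' :: state). reg s' ''i'' = lo + k \<and>
     mates n G (arr s' ''mt'') \<and> extends n f (arr s' ''mt'') \<and> avoids n (arr s' ''mt'') Y \<and>
     (\<forall>j. lo \<le> j \<longrightarrow> j < lo + k \<longrightarrow> decode n (Q j) \<in> G \<longrightarrow> decode n (Q j) \<notin> Y \<longrightarrow>
        (\<exists>u\<in>decode n (Q j). arr s' ''mt'' u < n)))"
  have "\<exists>k s'. exec W w (While (Op Less (Reg ''i'') (Reg ''hi'')) match_unmarked_prog) s k s' \<and>
      k \<le> (hi - lo + 1) *
        (1 + exp_cost (Op Less (Reg ''i'') (Reg ''hi'')) + max_cost match_unmarked_prog) \<and>
      I (hi - lo) s' \<and> frame match_unmarked_prog s s'"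
  proof (rule exec_While_step)
    show "I 0 s" using i f by (simp add: I_def f_def extends_def)
  next
    fix k s' assume k: "k < hi - lo" and fr: "frame match_unmarked_prog s s'" and I: "I k s'"
    let ?e = "Q (lo + k)" and ?f = "arr s' ''mt''"
    have s': "reg s' ''n'' = n" "reg s' ''hi'' = hi" "arr s' ''Q'' = Q" "reg s' ''i'' = lo + k"
      "arr s' ''P'' = arr s ''P''" "arr s' ''mk'' = arr s ''mk''"
      using frameD[OF fr] I n i
      by (simp_all add: match_unmarked_prog_def match_prog_def prog_defs Q_def I_def)
    have e: "canonical n ?e" using Q k by simp
    define g where "g = (if decode n ?e \<in> Y then ?f else match_at n (arr s ''P'') ?e ?f)"
    have mk': "arr s ''mk'' ?e = 0 \<longleftrightarrow> decode n ?e \<notin> Y" using mk k by simp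
    have st: "arr (step w match_unmarked_prog s') ''mt'' = g"
      "reg (step w match_unmarked_prog s') ''i'' = lo + Suc k"
      using s' mk' step_match_prog[of "set_reg ''e'' ?e s'" n ?e w]
      by (auto simp: match_unmarked_prog_def prog_defs g_def)
    have f': "mates n G ?f" "extends n f ?f" "avoids n ?f Y" using I by (auto simp: I_def)
    have g: "mates n G g" "extends n ?f g" "avoids n g Y"
      "decode n ?e \<in> G \<Longrightarrow> decode n ?e \<notin> Y \<Longrightarrow> \<exists>u\<in>decode n ?e. g u < n"
      using match_at[OF f'(1) e f(3,2) f'(3)] f' by (auto simp: g_def extends_def)
    have "\<exists>u\<in>decode n (Q j). g u < n"
      if j: "lo \<le> j" "j < lo + Suc k" "decode n (Q j) \<in> G" "decode n (Q j) \<notin> Y" for j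
    proof (cases "j = lo + k")
      case True
      then show ?thesis using g(4) j by simp
    next
      case False
      with j I obtain u where "u \<in> decode n (Q j)" "?f u < n" unfolding I_def by force
      with g(2) show ?thesis by (intro bexI[of _ u]) (simp_all add: extends_def)
    qed
    then have "I (Suc k) (step w match_unmarked_prog s')"
      unfolding I_def st using g f' extends_trans by blast
    moreover have "Suc (lo + k) < W" using k i by linarith
    then have "safe W w match_unmarked_prog s'"
      using s' e n i k safe_match_prog[of "set_reg ''e'' ?e s'" n ?e W w]
        step_match_prog[of "set_reg ''e'' ?e s'" n ?e w]
      by (simp add: match_unmarked_prog_def prog_defs canonical_def)
    ultimately show "eval w s' (Op Less (Reg ''i'') (Reg ''hi'')) \<noteq> 0 \<and>
      safe W w match_unmarked_prog s' \<and> I (Suc k) (step w match_unmarked_prog s')"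
      using s' k by simp
  next
    fix s' assume fr: "frame match_unmarked_prog s s'" and I: "I (hi - lo) s'"
    then show "eval w s' (Op Less (Reg ''i'') (Reg ''hi'')) = 0"
      using i frameD[OF fr] by (simp add: I_def match_unmarked_prog_def match_prog_def prog_defs)
  qed
  then obtain k s' where
    "exec W w (While (Op Less (Reg ''i'') (Reg ''hi'')) match_unmarked_prog) s k s'"
    "k \<le> (hi - lo + 1) *
      (1 + exp_cost (Op Less (Reg ''i'') (Reg ''hi'')) + max_cost match_unmarked_prog)"
    "I (hi - lo) s'" "frame match_unmarked_prog s s'" by blast
  moreover from this(2) have "k \<le> (hi - lo + 1) * 60"
    by (rule order_trans[OF _ mult_left_mono])
      (simp_all add: match_unmarked_prog_def match_prog_def prog_defs)
  ultimately show ?thesis using i(3) unfolding I_def by (intro exI[of _ k] exI[of _ s']) simp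
qed

text \<open>Shrinking the prefix from \<open>T (Suc c)\<close> to \<open>T c\<close> exposes at most
  the one edge at position \<open>c\<close>, and exactly this edge is tried then. Coverage of the
  longer prefixes persists because the matching only grows. Reaching \<open>T a\<close>, which is
  empty, gives maximality.\<close>

lemma exec_match_marked:
  fixes s :: state and n :: nat
  defines "Q \<equiv> arr s ''Q''" and "f \<equiv> arr s ''mt''"
  defines "T \<equiv> \<lambda>j. decode n ` Q ` {reg s ''a''..<j}"
  assumes n: "reg s ''n'' = n" "n * n < W" "n < W"
    and i: "reg s ''i'' = b" "reg s ''a'' = a" "a \<le> b" "b < W"
    and Q: "\<And>j. a \<le> j \<Longrightarrow> j < b \<Longrightarrow> canonical n (Q j)"
    and f: "mates n G f" "simple_graph n G" "represents n G (arr s ''P'')" "avoids n f (T b)"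
      "covers n G f (T b)"
    and mk: "\<And>j. a \<le> j \<Longrightarrow> j < b \<Longrightarrow> arr s ''mk'' (Q j) = Suc j \<longleftrightarrow> Q j \<notin> Q ` {a..<j}"
  shows "\<exists>k s'. exec W w (While (Op Less (Reg ''a'') (Reg ''i'')) match_marked_prog) s k s' \<and>
    k \<le> (b - a + 1) * 60 \<and>
    (mates n G (arr s' ''mt'') \<and> extends n f (arr s' ''mt'') \<and>
     (\<forall>j. a \<le> j \<longrightarrow> j \<le> b \<longrightarrow> covers n G (arr s' ''mt'') (T j))) \<and>
    frame match_marked_prog s s'"
proof -
  define I where "I = (\<lambda>k (s' :: state). reg s' ''i'' = b - k \<and>
     mates n G (arr s' ''mt'') \<and> extends n f (arr s' ''mt'') \<and> avoids n (arr s' ''mt'') (T (b - k)) \<and>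
     (\<forall>j. b - k \<le> j \<longrightarrow> j \<le> b \<longrightarrow> covers n G (arr s' ''mt'') (T j)))"
  have "\<exists>k s'. exec W w (While (Op Less (Reg ''a'') (Reg ''i'')) match_marked_prog) s k s' \<and>
      k \<le> (b - a + 1) *
        (1 + exp_cost (Op Less (Reg ''a'') (Reg ''i'')) + max_cost match_marked_prog) \<and>
      I (b - a) s' \<and> frame match_marked_prog s s'"
  proof (rule exec_While_step)
    show "I 0 s" using i f by (auto simp: I_def f_def extends_def)
  next
    fix k s' assume k: "k < b - a" and fr: "frame match_marked_prog s s'" and I: "I k s'"
    define c where "c = b - Suc k"
    have c: "b - k = Suc c" "a \<le> c" "c < b" using k by (auto simp: c_def)
    let ?e = "Q c" and ?f = "arr s' ''mt''"
    have s': "reg s' ''n'' = n" "reg s' ''a'' = a" "arr s' ''Q'' = Q" "reg s' ''i'' = Suc c"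
      "arr s' ''P'' = arr s ''P''" "arr s' ''mk'' = arr s ''mk''"
      using frameD[OF fr] I n i c
      by (simp_all add: match_marked_prog_def match_prog_def prog_defs Q_def I_def)
    have e: "canonical n ?e" using Q c by simp
    \<comment> \<open>If the edge also occurs earlier, then \<open>T (Suc c) = T c\<close>; matching
      it now would violate \<open>avoids\<close> for the shorter prefix.\<close>
    define g where "g = (if ?e \<in> Q ` {a..<c} then ?f else match_at n (arr s ''P'') ?e ?f)"
    have mk': "arr s ''mk'' ?e = Suc c \<longleftrightarrow> ?e \<notin> Q ` {a..<c}" using mk c by simp
    have st: "arr (step w match_marked_prog s') ''mt'' = g"
      "reg (step w match_marked_prog s') ''i'' = c"
      using s' mk' step_match_prog[of "set_reg ''e'' ?e (set_reg ''i'' c s')" n ?e w]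
      by (auto simp: match_marked_prog_def prog_defs g_def)
    have TS: "T (Suc c) = insert (decode n ?e) (T c)"
      using c(2) i by (simp add: T_def atLeastLessThanSuc)
    have dT: "decode n ?e \<in> T c \<longleftrightarrow> ?e \<in> Q ` {a..<c}"
    proof
      assume "decode n ?e \<in> T c"
      then obtain j where "a \<le> j" "j < c" "decode n ?e = decode n (Q j)"
        using i by (auto simp: T_def)
      with decode_inj[OF e Q] c show "?e \<in> Q ` {a..<c}" by auto
    qed (use i in \<open>auto simp: T_def\<close>)
    have f': "mates n G ?f" "extends n f ?f" "avoids n ?f (T (Suc c))"
      using I c(1) by (auto simp: I_def)
    have av: "avoids n ?f (T c)" using avoids_subset[OF f'(3)] TS by blast
    have cov: "covers n G ?f (T j)" if "Suc c \<le> j" "j \<le> b" for j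
      using I that unfolding I_def c(1) by blast
    have g: "mates n G g" "extends n ?f g" "avoids n g (T c)"
      "decode n ?e \<in> G \<Longrightarrow> decode n ?e \<notin> T c \<Longrightarrow> \<exists>u\<in>decode n ?e. g u < n"
      using match_at[OF f'(1) e f(3,2) av] f' av by (auto simp: g_def extends_def dT)
    have "covers n G g (T j)" if j: "c \<le> j" "j \<le> b" for j
    proof (cases "j = c")
      case True
      show ?thesis
        unfolding covers_def True
      proof (intro ballI impI)
        fix x assume x: "x \<in> G" "x \<notin> T c"
        have "\<exists>u\<in>x. g u < n"
        proof (cases "x = decode n ?e")
          case True
          then show ?thesis using g(4) x by simp
        next
          case False
          with x TS have "x \<notin> T (Suc c)" by simp
          with x(1) cov[of "Suc c"] c obtain u where "u \<in> x" "?f u < n"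
            unfolding covers_def by auto
          with g(2) show ?thesis by (intro bexI[of _ u]) (simp_all add: extends_def)
        qed
        then obtain u where u: "u \<in> x" "g u < n" by blast
        from x(1) f(2) obtain p q where "x = {p, q}" "p < n" "q < n"
          by (rule simple_graphE)
        with u have "u < n" by auto
        \<comment> \<open>No edge of \<open>T c\<close> is matched yet, so any matched endpoint
          qualifies.\<close>
        with g(3) u show "\<exists>u\<in>x. g u < n \<and> {u, g u} \<notin> T c" unfolding avoids_def by blast
      qed
    next
      case False
      then show ?thesis using covers_extends[OF cov g(2)] j by simp
    qed
    then have "I (Suc k) (step w match_marked_prog s')"
      unfolding I_def st c_def[symmetric] using g f' extends_trans by blast
    moreover have "safe W w match_marked_prog s'"
      using s' e n i c safe_match_prog[of "set_reg ''e'' ?e (set_reg ''i'' c s')" n ?e W w]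
      by (simp add: match_marked_prog_def prog_defs canonical_def)
    ultimately show "eval w s' (Op Less (Reg ''a'') (Reg ''i'')) \<noteq> 0 \<and>
      safe W w match_marked_prog s' \<and> I (Suc k) (step w match_marked_prog s')"
      using s' c by simp
  next
    fix s' assume fr: "frame match_marked_prog s s'" and I: "I (b - a) s'"
    then show "eval w s' (Op Less (Reg ''a'') (Reg ''i'')) = 0"
      using i frameD[OF fr] by (simp add: I_def match_marked_prog_def match_prog_def prog_defs)
  qed
  then obtain k s' where
    "exec W w (While (Op Less (Reg ''a'') (Reg ''i'')) match_marked_prog) s k s'"
    "k \<le> (b - a + 1) *
      (1 + exp_cost (Op Less (Reg ''a'') (Reg ''i'')) + max_cost match_marked_prog)"
    "I (b - a) s'" "frame match_marked_prog s s'" by blast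
  moreover from this(2) have "k \<le> (b - a + 1) * 60"
    by (rule order_trans[OF _ mult_left_mono])
      (simp_all add: match_marked_prog_def match_prog_def prog_defs)
  ultimately show ?thesis using i(3) unfolding I_def by (intro exI[of _ k] exI[of _ s']) simp
qed

section \<open>Collecting the edges relevant for a batch\<close>

definition clear_prog :: com where
  "clear_prog = Seq (Store ''mk'' (Cell ''Q'' (Reg ''i'')) (Const 0)) advance"

text \<open>Compaction in place: \<open>P\<close> drops absent edges and \<open>mk\<close> drops
  duplicates, so that the surviving entries can be counted against the edges of the current
  graph.\<close>

definition compact_prog :: com where
  "compact_prog = Seq fetch (Seq
     (If (Cell ''P'' (Reg ''e''))
       (If (Cell ''mk'' (Reg ''e'')) Skip
         (Seq (Store ''mk'' (Reg ''e'') (Const 1))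
           (Seq (Store ''Q'' (Reg ''r'') (Reg ''e'')) (Assign ''r'' (Op Add (Reg ''r'') (Const 1))))))
       Skip) advance)"

definition code_exp :: exp where
  "code_exp =
     Op Add (Op Mul (Op Less (Reg ''x'') (Reg ''y''))
       (Op Add (Op Mul (Reg ''x'') (Reg ''n'')) (Reg ''y'')))
      (Op Mul (Op Less (Reg ''y'') (Reg ''x''))
       (Op Add (Op Mul (Reg ''y'') (Reg ''n'')) (Reg ''x'')))"

definition load_prog :: com where
  "load_prog = Seq (Assign ''x'' (LookFst (Reg ''i''))) (Seq (Assign ''y'' (LookSnd (Reg ''i'')))
     (Seq (Store ''Q'' (Op Add (Reg ''r'') (Reg ''i'')) code_exp) advance))"

definition double_prog :: com where
  "double_prog = Assign ''h'' (Op Mul (Const 2) (Reg ''h''))"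

text \<open>The factor comparing with \<open>K\<close> stops the doubling at p = 0, which all powers
  of two divide.\<close>

definition double_cond :: exp where
  "double_cond = Op Mul (Op Eq (Op Mod (Reg ''p'') (Op Mul (Const 2) (Reg ''h''))) (Const 0))
     (Op Less (Reg ''h'') (Reg ''K''))"

lemma eval_code_exp: "eval w s code_exp = code (reg s ''n'') (reg s ''x'') (reg s ''y'')"
  by (auto simp: code_exp_def code_def)

lemma exec_clear:
  fixes s :: state
  defines "Q \<equiv> arr s ''Q''"
  assumes i: "reg s ''i'' = 0" "reg s ''len'' = len" "len < W"
    and Q: "\<And>j. j < len \<Longrightarrow> Q j < W"
  shows "\<exists>k s'. exec W w (While (Op Less (Reg ''i'') (Reg ''len'')) clear_prog) s k s' \<and>
    k \<le> (len + 1) * 60 \<and> (\<forall>j<len. arr s' ''mk'' (Q j) = 0) \<and> frame clear_prog s s'"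
proof -
  define I where "I = (\<lambda>k (s' :: state). reg s' ''i'' = k \<and> (\<forall>j<k. arr s' ''mk'' (Q j) = 0))"
  have "\<exists>k s'. exec W w (While (Op Less (Reg ''i'') (Reg ''len'')) clear_prog) s k s' \<and>
      k \<le> (len + 1) * (1 + exp_cost (Op Less (Reg ''i'') (Reg ''len'')) + max_cost clear_prog) \<and>
      I len s' \<and> frame clear_prog s s'"
  proof (rule exec_While_step)
    show "I 0 s" using i by (simp add: I_def)
  next
    fix k s' assume k: "k < len" and fr: "frame clear_prog s s'" and I: "I k s'"
    have s': "reg s' ''len'' = len" "arr s' ''Q'' = Q" "reg s' ''i'' = k"
      using frameD[OF fr] I i by (simp_all add: clear_prog_def prog_defs Q_def I_def)
    have "I (Suc k) (step w clear_prog s')" "safe W w clear_prog s'"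
      using I s' k Q[OF k] i by (auto simp: I_def clear_prog_def prog_defs less_Suc_eq)
    then show "eval w s' (Op Less (Reg ''i'') (Reg ''len'')) \<noteq> 0 \<and> safe W w clear_prog s' \<and>
      I (Suc k) (step w clear_prog s')"
      using s' k by simp
  next
    fix s' assume fr: "frame clear_prog s s'" and I: "I len s'"
    then show "eval w s' (Op Less (Reg ''i'') (Reg ''len'')) = 0"
      using i frameD[OF fr] by (simp add: I_def clear_prog_def prog_defs)
  qed
  then obtain k s' where "exec W w (While (Op Less (Reg ''i'') (Reg ''len'')) clear_prog) s k s'"
    "k \<le> (len + 1) * (1 + exp_cost (Op Less (Reg ''i'') (Reg ''len'')) + max_cost clear_prog)"
    "I len s'" "frame clear_prog s s'" by blast
  moreover from this(2) have "k \<le> (len + 1) * 60"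
    by (rule order_trans[OF _ mult_left_mono]) (simp_all add: clear_prog_def prog_defs)
  ultimately show ?thesis unfolding I_def by (intro exI[of _ k] exI[of _ s']) simp
qed

lemma exec_compact:
  fixes s :: state
  defines "Q \<equiv> arr s ''Q''"
  assumes i: "reg s ''i'' = 0" "reg s ''r'' = 0" "reg s ''len'' = len" "len < W" "1 < W"
    and Q: "\<And>j. j < len \<Longrightarrow> Q j < W"
    and mk: "\<forall>j<len. arr s ''mk'' (Q j) = 0"
  shows "\<exists>k s'. exec W w (While (Op Less (Reg ''i'') (Reg ''len'')) compact_prog) s k s' \<and>
    k \<le> (len + 1) * 60 \<and>
    (\<exists>r. reg s' ''r'' = r \<and> r \<le> len \<and> inj_on (arr s' ''Q'') {..<r} \<and>
      arr s' ''Q'' ` {..<r} = {e \<in> Q ` {..<len}. arr s ''P'' e \<noteq> 0}) \<and>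
    frame compact_prog s s'"
proof -
  \<comment> \<open>The write index never overtakes the read index, so the unread suffix is still
    the original list; marks are set exactly for the codes already kept.\<close>
  define I where "I = (\<lambda>k (s' :: state). reg s' ''i'' = k \<and> reg s' ''r'' \<le> k \<and>
     (\<forall>j. k \<le> j \<longrightarrow> j < len \<longrightarrow> arr s' ''Q'' j = Q j) \<and>
     inj_on (arr s' ''Q'') {..<reg s' ''r''} \<and>
     arr s' ''Q'' ` {..<reg s' ''r''} = {e \<in> Q ` {..<k}. arr s ''P'' e \<noteq> 0} \<and>
     (\<forall>j<len. arr s' ''mk'' (Q j) \<noteq> 0 \<longleftrightarrow> Q j \<in> arr s' ''Q'' ` {..<reg s' ''r''}))"
  have "\<exists>k s'. exec W w (While (Op Less (Reg ''i'') (Reg ''len'')) compact_prog) s k s' \<and>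
      k \<le> (len + 1) * (1 + exp_cost (Op Less (Reg ''i'') (Reg ''len'')) + max_cost compact_prog) \<and>
      I len s' \<and> frame compact_prog s s'"
  proof (rule exec_While_step)
    show "I 0 s" using i mk by (simp add: I_def Q_def)
  next
    fix k s' assume k: "k < len" and fr: "frame compact_prog s s'" and I: "I k s'"
    have s': "reg s' ''len'' = len" "arr s' ''Q'' k = Q k" "reg s' ''i'' = k"
      "arr s' ''P'' = arr s ''P''" "reg s' ''r'' \<le> k"
      using frameD[OF fr] I i k by (simp_all add: compact_prog_def prog_defs I_def)
    let ?q = "arr s' ''Q''" and ?r = "reg s' ''r''"
    have mk': "arr s' ''mk'' (Q k) \<noteq> 0 \<longleftrightarrow> Q k \<in> ?q ` {..<?r}"
      and inj: "inj_on ?q {..<?r}"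
      and im: "?q ` {..<?r} = {e \<in> Q ` {..<k}. arr s ''P'' e \<noteq> 0}"
      and rest: "\<And>j. k \<le> j \<Longrightarrow> j < len \<Longrightarrow> ?q j = Q j"
      and mks: "\<And>j. j < len \<Longrightarrow> arr s' ''mk'' (Q j) \<noteq> 0 \<longleftrightarrow> Q j \<in> ?q ` {..<?r}"
      using I k unfolding I_def by blast+
    have "I (Suc k) (step w compact_prog s')"
    proof (cases "arr s ''P'' (Q k) \<noteq> 0 \<and> Q k \<notin> ?q ` {..<?r}")
      case True
      have st: "reg (step w compact_prog s') ''i'' = Suc k"
        "reg (step w compact_prog s') ''r'' = Suc ?r"
        "arr (step w compact_prog s') ''Q'' = ?q(?r := Q k)"
        "arr (step w compact_prog s') ''mk'' = (arr s' ''mk'')(Q k := 1)"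
        using s' True mk' by (simp_all add: compact_prog_def prog_defs)
      have im': "(?q(?r := Q k)) ` {..<?r} = ?q ` {..<?r}" by (rule image_cong) auto
      show ?thesis
        unfolding I_def st
      proof (intro conjI allI impI)
        show "inj_on (?q(?r := Q k)) {..<Suc ?r}"
          using inj True unfolding lessThan_Suc inj_on_insert im'
          by (auto simp: inj_on_def)
        show "(?q(?r := Q k)) ` {..<Suc ?r} = {e \<in> Q ` {..<Suc k}. arr s ''P'' e \<noteq> 0}"
          using True unfolding lessThan_Suc image_insert im' im by auto
        show "(((arr s' ''mk'')(Q k := 1)) (Q j) \<noteq> 0) =
            (Q j \<in> (?q(?r := Q k)) ` {..<Suc ?r})" if "j < len" for j
          using mks[OF that] unfolding lessThan_Suc image_insert im' by auto
        show "(?q(?r := Q k)) j = Q j" if "Suc k \<le> j" "j < len" for j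
          using rest[of j] that s'(5) by auto
      qed (use s' in auto)
    next
      case False
      have st: "reg (step w compact_prog s') ''i'' = Suc k"
        "reg (step w compact_prog s') ''r'' = ?r"
        "arr (step w compact_prog s') ''Q'' = ?q"
        "arr (step w compact_prog s') ''mk'' = arr s' ''mk''"
        using s' False mk' by (auto simp add: compact_prog_def prog_defs)
      have "{e \<in> Q ` {..<Suc k}. arr s ''P'' e \<noteq> 0} = {e \<in> Q ` {..<k}. arr s ''P'' e \<noteq> 0}"
        using False im by (auto simp: lessThan_Suc)
      then show ?thesis
        using inj im mks rest s'(5) unfolding I_def st by auto
    qed
    moreover have "safe W w compact_prog s'"
      using s' k Q[OF k] i by (auto simp: compact_prog_def prog_defs)
    ultimately show "eval w s' (Op Less (Reg ''i'') (Reg ''len'')) \<noteq> 0 \<and> safe W w compact_prog s' \<and>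
      I (Suc k) (step w compact_prog s')"
      using s' k by simp
  next
    fix s' assume fr: "frame compact_prog s s'" and I: "I len s'"
    then show "eval w s' (Op Less (Reg ''i'') (Reg ''len'')) = 0"
      using i frameD[OF fr] by (simp add: I_def compact_prog_def prog_defs)
  qed
  then obtain k s' where "exec W w (While (Op Less (Reg ''i'') (Reg ''len'')) compact_prog) s k s'"
    "k \<le> (len + 1) * (1 + exp_cost (Op Less (Reg ''i'') (Reg ''len'')) + max_cost compact_prog)"
    "I len s'" "frame compact_prog s s'" by blast
  moreover from this(2) have "k \<le> (len + 1) * 60"
    by (rule order_trans[OF _ mult_left_mono]) (simp_all add: compact_prog_def prog_defs)
  ultimately show ?thesis unfolding I_def by (intro exI[of _ k] exI[of _ s']) simp
qed

lemma exec_load: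
  fixes s :: state
  assumes i: "reg s ''i'' = 0" "reg s ''r'' = r" "reg s ''K'' = K" "r + K < W" "reg s ''n'' = n"
    and W: "n * n < W" "n < W"
    and look: "\<And>j. look fst_of w j < n" "\<And>j. look snd_of w j < n"
  shows "\<exists>k s'. exec W w (While (Op Less (Reg ''i'') (Reg ''K'')) load_prog) s k s' \<and>
    k \<le> (K + 1) * 60 \<and>
    ((\<forall>j<r. arr s' ''Q'' j = arr s ''Q'' j) \<and>
     (\<forall>j<K. arr s' ''Q'' (r + j) = code n (look fst_of w j) (look snd_of w j))) \<and>
    frame load_prog s s'"
proof -
  define I where "I = (\<lambda>k (s' :: state). reg s' ''i'' = k \<and>
     (\<forall>j<r. arr s' ''Q'' j = arr s ''Q'' j) \<and>
     (\<forall>j<k. arr s' ''Q'' (r + j) = code n (look fst_of w j) (look snd_of w j)))"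
  have "\<exists>k s'. exec W w (While (Op Less (Reg ''i'') (Reg ''K'')) load_prog) s k s' \<and>
      k \<le> (K + 1) * (1 + exp_cost (Op Less (Reg ''i'') (Reg ''K'')) + max_cost load_prog) \<and>
      I K s' \<and> frame load_prog s s'"
  proof (rule exec_While_step)
    show "I 0 s" using i by (simp add: I_def)
  next
    fix k s' assume k: "k < K" and fr: "frame load_prog s s'" and I: "I k s'"
    have s': "reg s' ''K'' = K" "reg s' ''r'' = r" "reg s' ''i'' = k" "reg s' ''n'' = n"
      using frameD[OF fr] I i by (simp_all add: load_prog_def prog_defs I_def)
    have c: "code n (look fst_of w k) (look snd_of w k) < W"
      using canonical_code[OF look(1)[of k] look(2)[of k]] W(1) by (simp add: canonical_def)
    have st: "reg (step w load_prog s') ''i'' = Suc k"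
      "arr (step w load_prog s') ''Q'' =
        (arr s' ''Q'')(r + k := code n (look fst_of w k) (look snd_of w k))"
      using s' by (simp_all add: load_prog_def prog_defs eval_code_exp)
    have "I (Suc k) (step w load_prog s')"
      using I unfolding I_def st by (auto simp: less_Suc_eq)
    moreover have "safe W w load_prog s'"
      using s' c k i W look[of k] by (simp add: load_prog_def prog_defs eval_code_exp)
    ultimately show "eval w s' (Op Less (Reg ''i'') (Reg ''K'')) \<noteq> 0 \<and> safe W w load_prog s' \<and>
      I (Suc k) (step w load_prog s')"
      using s' k by simp
  next
    fix s' assume fr: "frame load_prog s s'" and I: "I K s'"
    then show "eval w s' (Op Less (Reg ''i'') (Reg ''K'')) = 0"
      using i frameD[OF fr] by (simp add: I_def load_prog_def prog_defs)
  qed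
  then obtain k s' where "exec W w (While (Op Less (Reg ''i'') (Reg ''K'')) load_prog) s k s'"
    "k \<le> (K + 1) * (1 + exp_cost (Op Less (Reg ''i'') (Reg ''K'')) + max_cost load_prog)"
    "I K s'" "frame load_prog s s'" by blast
  moreover from this(2) have "k \<le> (K + 1) * 60"
    by (rule order_trans[OF _ mult_left_mono]) (simp_all add: load_prog_def code_exp_def prog_defs)
  ultimately show ?thesis unfolding I_def by (intro exI[of _ k] exI[of _ s']) simp
qed

text \<open>The cost is linear in \<open>j\<close> and is absorbed later by
  \<open>j + 1 <= 2^j\<close>, so finding the level is no dearer than renewing it.\<close>

lemma exec_double:
  fixes s :: state
  assumes h: "reg s ''h'' = 1" "reg s ''p'' = p" "reg s ''K'' = 2 ^ L" "2 ^ L < W"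
  shows "\<exists>k s'. exec W w (While double_cond double_prog) s k s' \<and>
    (\<exists>j\<le>L. k \<le> (j + 1) * 60 \<and> reg s' ''h'' = 2 ^ j \<and> 2 ^ j dvd p \<and>
      (j < L \<longrightarrow> \<not> 2 ^ Suc j dvd p)) \<and>
    frame double_prog s s'"
proof -
  define N where "N = Max {j. j \<le> L \<and> 2 ^ j dvd p}"
  have fin: "finite {j. j \<le> L \<and> 2 ^ j dvd p}" by simp
  have "N \<in> {j. j \<le> L \<and> 2 ^ j dvd p}"
    unfolding N_def by (rule Max_in[OF fin]) (auto intro: exI[of _ 0])
  then have N: "N \<le> L" "2 ^ N dvd p" by auto
  have max: "\<not> 2 ^ Suc N dvd p" if "N < L"
  proof
    assume "2 ^ Suc N dvd p"
    then have "Suc N \<le> N" using that unfolding N_def by (intro Max_ge[OF fin]) simp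
    then show False by simp
  qed
  define I where "I = (\<lambda>k (s' :: state). reg s' ''h'' = 2 ^ k)"
  have "\<exists>k s'. exec W w (While double_cond double_prog) s k s' \<and>
      k \<le> (N + 1) * (1 + exp_cost double_cond + max_cost double_prog) \<and>
      I N s' \<and> frame double_prog s s'"
  proof (rule exec_While_step)
    show "I 0 s" using h by (simp add: I_def)
  next
    fix k s' assume k: "k < N" and fr: "frame double_prog s s'" and I: "I k s'"
    have s': "reg s' ''p'' = p" "reg s' ''K'' = 2 ^ L" "reg s' ''h'' = 2 ^ k"
      using frameD[OF fr] I h by (simp_all add: double_prog_def I_def)
    have "(2::nat) ^ Suc k dvd 2 ^ N" using k by (intro le_imp_power_dvd) simp
    then have d: "2 ^ Suc k dvd p" using N(2) by (rule dvd_trans)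
    have "(2::nat) ^ Suc k \<le> 2 ^ L" "(2::nat) ^ k < 2 ^ L"
      using k N by (intro power_increasing power_strict_increasing; simp)+
    then show "eval w s' double_cond \<noteq> 0 \<and> safe W w double_prog s' \<and> I (Suc k) (step w double_prog s')"
      using s' d h by (simp add: double_cond_def double_prog_def I_def)
  next
    fix s' assume fr: "frame double_prog s s'" and I: "I N s'"
    then show "eval w s' double_cond = 0"
      using h frameD[OF fr] max N
      by (cases "N = L") (auto simp add: I_def double_prog_def double_cond_def dvd_eq_mod_eq_0)
  qed
  then obtain k s' where "exec W w (While double_cond double_prog) s k s'"
    "k \<le> (N + 1) * (1 + exp_cost double_cond + max_cost double_prog)"
    "I N s'" "frame double_prog s s'" by blast
  moreover from this(2) have "k \<le> (N + 1) * 60"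
    by (rule order_trans[OF _ mult_left_mono]) (simp_all add: double_prog_def double_cond_def)
  ultimately show ?thesis using N max unfolding I_def
    by (intro exI[of _ k] exI[of _ s'] conjI exI[of _ N]) simp_all
qed

section \<open>Renewing the matching on one range of the list\<close>

definition for_up :: "com \<Rightarrow> com" where
  "for_up c = Seq (Assign ''i'' (Reg ''lo'')) (While (Op Less (Reg ''i'') (Reg ''hi'')) c)"

definition for_down :: "com \<Rightarrow> com" where
  "for_down c = Seq (Assign ''i'' (Reg ''b'')) (While (Op Less (Reg ''a'') (Reg ''i'')) c)"

definition rematch_prog :: com where
  "rematch_prog = Seq (for_up unmatch_prog) (Seq (for_down mark_prog)
     (Seq (for_up match_unmarked_prog) (for_down match_marked_prog)))"

lemma exec_Assign_Seq:
  assumes "exec W w c (set_reg x v s) k s'" "eval w s e = v" "v < W"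
  shows "exec W w (Seq (Assign x e) c) s (k + exp_cost e + 2) s'"
  using exec.Seq[OF exec.Assign[of w s e W x]] assms by (fastforce simp: add.commute)

text \<open>Both the update and the unmatching stay inside \<open>X\<close>. Hence for every
  \<open>Y\<close> containing \<open>X\<close> the edges and the matched edges outside
  \<open>Y\<close> are the same before and after, although the graph passes from \<open>G0\<close>
  to \<open>G\<close>.\<close>

lemma mates_remove:
  assumes f: "mates n G0 f" and G: "\<forall>e. e \<notin> X \<longrightarrow> (e \<in> G0 \<longleftrightarrow> e \<in> G)"
    and g: "\<forall>u<n. g u = (if f u < n \<and> {u, f u} \<in> X then n else f u)"
  shows "mates n G g" "avoids n g X"
    "\<And>Y. simple_graph n G \<Longrightarrow> covers n G0 f Y \<Longrightarrow> X \<subseteq> Y \<Longrightarrow> covers n G g Y"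
proof -
  show "mates n G g"
    unfolding mates_def
  proof (intro allI impI)
    fix u assume u: "u < n"
    show "g u \<le> n \<and> (g u < n \<longrightarrow> g u \<noteq> u \<and> g (g u) = u \<and> {u, g u} \<in> G)"
    proof (cases "f u < n \<and> {u, f u} \<notin> X")
      case True
      with g u have gu: "g u = f u" by simp
      have fu: "f u \<noteq> u" "f (f u) = u" "{u, f u} \<in> G0"
        using matesD(2)[OF f u] True by auto
      have "{f u, f (f u)} \<notin> X" using True fu(2) by (simp add: insert_commute)
      then have "g (f u) = u" using g True fu(2) by simp
      with gu fu G[rule_format, of "{u, f u}"] True show ?thesis by simp
    next
      case False
      then have "g u = n" using g u matesD(1)[OF f u] by auto
      then show ?thesis by simp
    qed
  qed
  show "avoids n g X" using g by (auto simp: avoids_def)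
  fix Y assume G': "simple_graph n G" and c: "covers n G0 f Y" "X \<subseteq> Y"
  show "covers n G g Y"
    unfolding covers_def
  proof (intro ballI impI)
    fix e assume e: "e \<in> G" "e \<notin> Y"
    with c(2) have "e \<notin> X" by auto
    with e(1) G have "e \<in> G0" by simp
    with c(1) e(2) obtain u where u: "u \<in> e" "f u < n" "{u, f u} \<notin> Y"
      unfolding covers_def by auto
    obtain p q where "e = {p, q}" "p < n" "q < n" using e(1) G' by (auto simp: simple_graph_def)
    with u(1) have "u < n" by auto
    with g u(2,3) c(2) have "g u = f u" by auto
    with u show "\<exists>u\<in>e. g u < n \<and> {u, g u} \<notin> Y" by (intro bexI[of _ u]) simp_all
  qed
qed

text \<open>\<open>G0\<close> and \<open>G\<close> are the graphs before and after the update, and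
  \<open>X\<close> is the surrounding block. The two coverage conclusions split the levels: sets
  containing \<open>X\<close> (the higher levels) keep their coverage, and the prefixes of
  \<open>{a..<b}\<close> (the levels renewed) obtain theirs anew.\<close>

lemma exec_rematch:
  fixes s :: state and n :: nat
  defines "Q \<equiv> arr s ''Q''" and "f \<equiv> arr s ''mt''"
  assumes n: "reg s ''n'' = n" "n * n < W" "n < W"
    and i: "reg s ''lo'' = lo" "reg s ''hi'' = hi" "reg s ''a'' = a" "reg s ''b'' = b"
      "lo \<le> a" "a \<le> b" "b \<le> hi" "hi < W"
    and Q: "\<And>j. lo \<le> j \<Longrightarrow> j < hi \<Longrightarrow> canonical n (Q j)"
    and X: "X = decode n ` Q ` {lo..<hi}"
    and f: "mates n G0 f" "simple_graph n G" "represents n G (arr s ''P'')"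
      "covers n G0 f X" "\<forall>e. e \<notin> X \<longrightarrow> (e \<in> G0 \<longleftrightarrow> e \<in> G)"
  shows "\<exists>k s'. exec W w rematch_prog s k s' \<and>
    k \<le> 240 * (hi - lo) + 300 \<and>
    mates n G (arr s' ''mt'') \<and>
    (\<forall>Y. X \<subseteq> Y \<longrightarrow> covers n G0 f Y \<longrightarrow> covers n G (arr s' ''mt'') Y) \<and>
    (\<forall>j. a \<le> j \<longrightarrow> j \<le> b \<longrightarrow> covers n G (arr s' ''mt'') (decode n ` Q ` {a..<j}))"
proof -
  let ?T = "decode n ` Q ` {a..<b}"
  have TX: "?T \<subseteq> X" unfolding X using i by (intro image_mono) auto
  have bounds: "lo < W" "b < W" using i by auto
  have QW: "Q j < W" if "lo \<le> j" "j < hi" for j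
    using Q[OF that] n(2) by (simp add: canonical_def)
  obtain k1 s1 where e1: "exec W w (While (Op Less (Reg ''i'') (Reg ''hi'')) unmatch_prog)
      (set_reg ''i'' lo s) k1 s1"
    and k1: "k1 \<le> (hi - lo + 1) * 60"
    and mt1: "\<forall>u<n. arr s1 ''mt'' u =
      (if f u < n \<and> {u, f u} \<in> decode n ` Q ` {lo..<hi} then n else f u)"
    and mk1: "\<And>j. lo \<le> j \<Longrightarrow> j < hi \<Longrightarrow> arr s1 ''mk'' (Q j) = 0"
    and fr1: "frame unmatch_prog (set_reg ''i'' lo s) s1"
    using exec_unmatch[of "set_reg ''i'' lo s" n W lo hi G0 w] n i Q f
    by (auto simp: Q_def f_def)
  have s1: "reg s1 ''n'' = n" "reg s1 ''lo'' = lo" "reg s1 ''hi'' = hi" "reg s1 ''a'' = a"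
    "reg s1 ''b'' = b" "arr s1 ''Q'' = Q" "arr s1 ''P'' = arr s ''P''"
    using frameD[OF fr1] n i by (simp_all add: unmatch_prog_def prog_defs Q_def)
  note rm = mates_remove[OF f(1,5) mt1[folded X]]
  obtain k2 s2 where e2: "exec W w (While (Op Less (Reg ''a'') (Reg ''i'')) mark_prog)
      (set_reg ''i'' b s1) k2 s2"
    and k2: "k2 \<le> (b - a + 1) * 60"
    and mk2: "\<And>e. e \<notin> Q ` {a..<b} \<Longrightarrow> arr s2 ''mk'' e = arr s1 ''mk'' e"
      "\<And>j. a \<le> j \<Longrightarrow> j < b \<Longrightarrow> arr s2 ''mk'' (Q j) \<noteq> 0 \<and>
        (arr s2 ''mk'' (Q j) = Suc j \<longleftrightarrow> Q j \<notin> Q ` {a..<j})"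
    and fr2: "frame mark_prog (set_reg ''i'' b s1) s2"
    using exec_mark[of "set_reg ''i'' b s1" b a W w] s1 i QW bounds by auto
  have s2: "reg s2 ''n'' = n" "reg s2 ''lo'' = lo" "reg s2 ''hi'' = hi" "reg s2 ''a'' = a"
    "reg s2 ''b'' = b" "arr s2 ''Q'' = Q" "arr s2 ''P'' = arr s ''P''" "arr s2 ''mt'' = arr s1 ''mt''"
    using frameD[OF fr2] s1 by (simp_all add: mark_prog_def prog_defs)
  have mk: "arr s2 ''mk'' (Q j) = 0 \<longleftrightarrow> decode n (Q j) \<notin> ?T" if j: "lo \<le> j" "j < hi" for j
  proof -
    have "decode n (Q j) \<in> ?T \<longleftrightarrow> Q j \<in> Q ` {a..<b}"
    proof
      assume "decode n (Q j) \<in> ?T"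
      then obtain j' where j': "a \<le> j'" "j' < b" "decode n (Q j) = decode n (Q j')" by auto
      with decode_inj[OF Q[OF j] Q[of j']] i have "Q j = Q j'" by simp
      with j' show "Q j \<in> Q ` {a..<b}" by auto
    qed auto
    moreover have "arr s2 ''mk'' (Q j) \<noteq> 0" if "Q j \<in> Q ` {a..<b}"
    proof -
      from that obtain j' where "a \<le> j'" "j' < b" "Q j = Q j'" by auto
      then show ?thesis using mk2(2)[of j'] by simp
    qed
    ultimately show ?thesis using mk2(1)[of "Q j"] mk1[OF j] by auto
  qed
  obtain k3 s3 where e3: "exec W w (While (Op Less (Reg ''i'') (Reg ''hi'')) match_unmarked_prog)
      (set_reg ''i'' lo s2) k3 s3"
    and k3: "k3 \<le> (hi - lo + 1) * 60"
    and mt3: "mates n G (arr s3 ''mt'')" "extends n (arr s1 ''mt'') (arr s3 ''mt'')"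
      "avoids n (arr s3 ''mt'') ?T"
    and done3: "\<And>j. lo \<le> j \<Longrightarrow> j < hi \<Longrightarrow> decode n (Q j) \<in> G \<Longrightarrow> decode n (Q j) \<notin> ?T \<Longrightarrow>
      \<exists>u\<in>decode n (Q j). arr s3 ''mt'' u < n"
    and fr3: "frame match_unmarked_prog (set_reg ''i'' lo s2) s3"
    using exec_match_unmarked[of "set_reg ''i'' lo s2" n W lo hi G ?T w] s2 n i Q f(2,3) mk
      rm(1) avoids_subset[OF rm(2) TX] by auto
  have s3: "reg s3 ''n'' = n" "reg s3 ''a'' = a" "reg s3 ''b'' = b" "arr s3 ''Q'' = Q"
    "arr s3 ''P'' = arr s ''P''" "arr s3 ''mk'' = arr s2 ''mk''"
    using frameD[OF fr3] s2 by (simp_all add: match_unmarked_prog_def match_prog_def prog_defs)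
  \<comment> \<open>An edge outside \<open>?T\<close> was either just tried, if it lies in
    \<open>X\<close>, or is still covered by an edge outside \<open>X\<close>. The blocking edge is
    outside \<open>?T\<close> because nothing in \<open>?T\<close> is matched.\<close>
  have cov3: "covers n G (arr s3 ''mt'') ?T"
    unfolding covers_def
  proof (intro ballI impI)
    fix e assume e: "e \<in> G" "e \<notin> ?T"
    have "\<exists>u\<in>e. arr s3 ''mt'' u < n"
    proof (cases "e \<in> X")
      case True
      then obtain j where "lo \<le> j" "j < hi" "e = decode n (Q j)" unfolding X by auto
      with done3 e show ?thesis by simp
    next
      case False
      have "covers n G (arr s3 ''mt'') X"
        using covers_extends[OF rm(3)[OF f(2,4) order_refl] mt3(2)] .
      with False e(1) show ?thesis unfolding covers_def by auto
    qed
    then obtain u where u: "u \<in> e" "arr s3 ''mt'' u < n" by auto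
    obtain p q where "e = {p, q}" "p < n" "q < n" using e(1) f(2) by (auto simp: simple_graph_def)
    with u(1) have "u < n" by auto
    with u mt3(3) show "\<exists>u\<in>e. arr s3 ''mt'' u < n \<and> {u, arr s3 ''mt'' u} \<notin> ?T"
      by (intro bexI[of _ u]) (simp_all add: avoids_def)
  qed
  obtain k4 s4 where e4: "exec W w (While (Op Less (Reg ''a'') (Reg ''i'')) match_marked_prog)
      (set_reg ''i'' b s3) k4 s4"
    and k4: "k4 \<le> (b - a + 1) * 60"
    and mt4: "mates n G (arr s4 ''mt'')" "extends n (arr s3 ''mt'') (arr s4 ''mt'')"
      "\<And>j. a \<le> j \<Longrightarrow> j \<le> b \<Longrightarrow> covers n G (arr s4 ''mt'') (decode n ` Q ` {a..<j})"
    using exec_match_marked[of "set_reg ''i'' b s3" n W b a G w] s3 n i Q f(2,3) mk2(2) mt3(1,3)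
      cov3 bounds by auto
  have ex: "extends n (arr s1 ''mt'') (arr s4 ''mt'')" using extends_trans[OF mt3(2) mt4(2)] .
  have x1: "exec W w (for_up unmatch_prog) s (k1 + 3) s1"
    unfolding for_up_def using exec_Assign_Seq[OF e1, of "Reg ''lo''"] i bounds
    by (simp add: eval_nat_numeral)
  have x2: "exec W w (for_down mark_prog) s1 (k2 + 3) s2"
    unfolding for_down_def using exec_Assign_Seq[OF e2, of "Reg ''b''"] s1 bounds
    by (simp add: eval_nat_numeral)
  have x3: "exec W w (for_up match_unmarked_prog) s2 (k3 + 3) s3"
    unfolding for_up_def using exec_Assign_Seq[OF e3, of "Reg ''lo''"] s2 bounds
    by (simp add: eval_nat_numeral)
  have x4: "exec W w (for_down match_marked_prog) s3 (k4 + 3) s4"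
    unfolding for_down_def using exec_Assign_Seq[OF e4, of "Reg ''b''"] s3 bounds
    by (simp add: eval_nat_numeral)
  have "exec W w rematch_prog s (k1 + k2 + k3 + k4 + 15) s4"
    unfolding rematch_prog_def
    using exec.Seq[OF x1 exec.Seq[OF x2 exec.Seq[OF x3 x4]]]
    by (simp add: eval_nat_numeral ac_simps)
  moreover have "k1 + k2 + k3 + k4 + 15 \<le> 240 * (hi - lo) + 300"
    using k1 k2 k3 k4 i(5-7) by simp
  moreover have "\<forall>Y. X \<subseteq> Y \<longrightarrow> covers n G0 f Y \<longrightarrow> covers n G (arr s4 ''mt'') Y"
    using covers_extends[OF rm(3) ex] f(2) by simp
  ultimately show ?thesis using mt4(1,3) by blast
qed

section \<open>The algorithm\<close>

text \<open>The marks left by earlier rounds are cleared first, since the compaction uses marks to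
  recognize duplicates. This is the only place where the stream is read beyond the current
  update.\<close>

definition reload_prog :: com where
  "reload_prog = Seq (Assign ''i'' (Const 0))
     (Seq (While (Op Less (Reg ''i'') (Reg ''len'')) clear_prog)
     (Seq (Assign ''i'' (Const 0)) (Seq (Assign ''r'' (Const 0))
     (Seq (While (Op Less (Reg ''i'') (Reg ''len'')) compact_prog)
     (Seq (Assign ''i'' (Const 0))
     (Seq (While (Op Less (Reg ''i'') (Reg ''K'')) load_prog)
       (Assign ''len'' (Op Add (Reg ''r'') (Reg ''K'')))))))))"

definition apply_prog :: com where
  "apply_prog = Seq (Assign ''x'' (LookFst (Const 0))) (Seq (Assign ''y'' (LookSnd (Const 0)))
     (Seq (Assign ''e'' code_exp)
     (Seq (Store ''P'' (Reg ''e'') (Op Eq (LookKind (Const 0)) (Const 1)))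
       (Assign ''h'' (Const 1)))))"

text \<open>For p > 0, \<open>p\<close> is an odd multiple of \<open>h\<close>, so the surrounding
  block of length 2h consists of the h positions before \<open>p\<close> and the h positions from
  \<open>p\<close> on. For p = 0 the range is the whole list, including the edges present at the
  batch start.\<close>

definition range_prog :: com where
  "range_prog = Seq (Assign ''a'' (Op Add (Reg ''r'') (Reg ''p'')))
     (Seq (Assign ''b'' (Op Add (Reg ''a'') (Reg ''h'')))
     (If (Reg ''p'')
       (Seq (Assign ''lo'' (Op Sub (Reg ''a'') (Reg ''h''))) (Assign ''hi'' (Reg ''b'')))
       (Seq (Assign ''lo'' (Const 0)) (Assign ''hi'' (Reg ''len'')))))"

definition next_prog :: com where
  "next_prog = Seq (Assign ''p'' (Op Add (Reg ''p'') (Const 1)))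
     (If (Op Eq (Reg ''p'') (Reg ''K'')) (Assign ''p'' (Const 0)) Skip)"

definition serve_prog :: com where
  "serve_prog = Seq apply_prog (Seq (While double_cond double_prog)
     (Seq range_prog (Seq rematch_prog next_prog)))"

text \<open>
  Zeroing the two registers that queries write makes the state after an update independent of
  the queries asked before it.
\<close>

definition lookahead_matching :: algorithm where
  "lookahead_matching = \<lparr>
     init_prog = Seq (Assign ''i'' (Const 0))
       (Seq (While (Op Less (Reg ''i'') (Op Mul (Reg ''n'') (Reg ''n'')))
         (Seq (Store ''P'' (Reg ''i'') (Const 0)) advance))
       (Seq (Assign ''i'' (Const 0))
       (Seq (While (Op Less (Reg ''i'') (Reg ''n'')) (Seq (Store ''mt'' (Reg ''i'') (Reg ''n'')) advance))
       (Seq (Assign ''K'' (Const 1))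
       (Seq (While (Op Less (Op Mul (Const 2) (Reg ''K'')) (Op Add (Reg ''m'') (Const 1)))
         (Assign ''K'' (Op Mul (Const 2) (Reg ''K''))))
       (Seq (Assign ''p'' (Const 0)) (Seq (Assign ''len'' (Const 0)) (Assign ''r'' (Const 0))))))))),
     update_prog = Seq (Assign ''u'' (Const 0)) (Seq (Assign ''mate'' (Const 0))
       (If (Reg ''m'') (Seq (If (Reg ''p'') Skip reload_prog) serve_prog) Skip)),
     query_prog = Assign ''mate'' (Cell ''mt'' (Reg ''u''))\<rparr>"

lemma exec_init:
  assumes n: "n * n < W" "n < W" "2 < W"
    and L: "2 ^ L \<le> max 1 m" "m < 2 * 2 ^ L" and mW: "m < W"
  shows "\<exists>k s'. run_init W lookahead_matching n m s k s' \<and>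
    k \<le> 60 * (n * n) + 60 * n + 60 * L + 300 \<and>
    reg s' ''n'' = n \<and> reg s' ''m'' = m \<and> reg s' ''K'' = 2 ^ L \<and> reg s' ''p'' = 0 \<and>
    reg s' ''len'' = 0 \<and> (\<forall>e<n * n. arr s' ''P'' e = 0) \<and> (\<forall>u<n. arr s' ''mt'' u = n)"
proof -
  let ?s0 = "set_reg ''n'' n (set_reg ''m'' m s)"
  let ?c1 = "Seq (Store ''P'' (Reg ''i'') (Const 0)) advance"
  let ?b1 = "Op Less (Reg ''i'') (Op Mul (Reg ''n'') (Reg ''n''))"
  let ?c2 = "Seq (Store ''mt'' (Reg ''i'') (Reg ''n'')) advance"
  let ?b2 = "Op Less (Reg ''i'') (Reg ''n'')"
  let ?c3 = "Assign ''K'' (Op Mul (Const 2) (Reg ''K''))"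
  let ?b3 = "Op Less (Op Mul (Const 2) (Reg ''K'')) (Op Add (Reg ''m'') (Const 1))"
  have "\<exists>k s'. exec W [] (While ?b1 ?c1) (set_reg ''i'' 0 ?s0) k s' \<and>
      k \<le> (n * n + 1) * (1 + exp_cost ?b1 + max_cost ?c1) \<and>
      (reg s' ''i'' = n * n \<and> (\<forall>e<n * n. arr s' ''P'' e = 0)) \<and> frame ?c1 (set_reg ''i'' 0 ?s0) s'"
    by (rule exec_While_step[where I = "\<lambda>k s'. reg s' ''i'' = k \<and> (\<forall>e<k. arr s' ''P'' e = 0)"])
      (use n in \<open>auto simp: frame_def advance_def less_Suc_eq\<close>)
  then obtain k1 s1 where e1: "exec W [] (While ?b1 ?c1) (set_reg ''i'' 0 ?s0) k1 s1"
    and k1: "k1 \<le> (n * n + 1) * (1 + exp_cost ?b1 + max_cost ?c1)"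
    and P: "\<forall>e<n * n. arr s1 ''P'' e = 0"
    and fr1: "frame ?c1 (set_reg ''i'' 0 ?s0) s1" by auto
  have s1: "reg s1 ''n'' = n" "reg s1 ''m'' = m"
    using frameD[OF fr1] by (simp_all add: advance_def)
  have "\<exists>k s'. exec W [] (While ?b2 ?c2) (set_reg ''i'' 0 s1) k s' \<and>
      k \<le> (n + 1) * (1 + exp_cost ?b2 + max_cost ?c2) \<and>
      (reg s' ''i'' = n \<and> (\<forall>u<n. arr s' ''mt'' u = n)) \<and> frame ?c2 (set_reg ''i'' 0 s1) s'"
    by (rule exec_While_step[where I = "\<lambda>k s'. reg s' ''i'' = k \<and> (\<forall>u<k. arr s' ''mt'' u = n)"])
      (use n s1 in \<open>auto simp: frame_def advance_def less_Suc_eq\<close>)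
  then obtain k2 s2 where e2: "exec W [] (While ?b2 ?c2) (set_reg ''i'' 0 s1) k2 s2"
    and k2: "k2 \<le> (n + 1) * (1 + exp_cost ?b2 + max_cost ?c2)"
    and mt: "\<forall>u<n. arr s2 ''mt'' u = n"
    and fr2: "frame ?c2 (set_reg ''i'' 0 s1) s2" by auto
  have s2: "reg s2 ''n'' = n" "reg s2 ''m'' = m" "arr s2 ''P'' = arr s1 ''P''"
    using frameD[OF fr2] s1 by (simp_all add: advance_def)
  have pow: "2 * 2 ^ k < m + 1 \<and> 2 * 2 ^ k < W" if "k < L" for k
  proof -
    have "(2::nat) ^ Suc k \<le> 2 ^ L" using that by (intro power_increasing) simp_all
    then have "2 * 2 ^ k \<le> max 1 m" using L(1) by simp
    \<comment> \<open>The left side is thus at least 2, so the maximum with 1 must be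
      \<open>m\<close> itself.\<close>
    moreover have "(1::nat) \<le> 2 ^ k" by simp
    ultimately have "2 * 2 ^ k \<le> m" by linarith
    then show ?thesis using mW by simp
  qed
  have "\<exists>k s'. exec W [] (While ?b3 ?c3) (set_reg ''K'' 1 s2) k s' \<and>
      k \<le> (L + 1) * (1 + exp_cost ?b3 + max_cost ?c3) \<and>
      reg s' ''K'' = 2 ^ L \<and> frame ?c3 (set_reg ''K'' 1 s2) s'"
    by (rule exec_While_step[where I = "\<lambda>k s'. reg s' ''K'' = 2 ^ k"])
      (use pow L s2 in \<open>auto simp: frame_def\<close>)
  then obtain k3 s3 where e3: "exec W [] (While ?b3 ?c3) (set_reg ''K'' 1 s2) k3 s3"
    and k3: "k3 \<le> (L + 1) * (1 + exp_cost ?b3 + max_cost ?c3)"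
    and K: "reg s3 ''K'' = 2 ^ L"
    and fr3: "frame ?c3 (set_reg ''K'' 1 s2) s3" by auto
  have s3: "reg s3 ''n'' = n" "reg s3 ''m'' = m" "arr s3 ''P'' = arr s1 ''P''"
    "arr s3 ''mt'' = arr s2 ''mt''"
    using frameD[OF fr3] s2 by simp_all
  let ?d = "Seq (Assign ''p'' (Const 0)) (Seq (Assign ''len'' (Const 0)) (Assign ''r'' (Const 0)))"
  obtain k4 where e4: "exec W [] ?d s3 k4 (step [] ?d s3)" and k4: "k4 \<le> max_cost ?d"
    using exec_step[of W "[]" ?d s3] n by auto
  have z: "0 < W" "1 < W" using n by auto
  have "exec W [] (init_prog lookahead_matching) ?s0 (k1 + k2 + k3 + k4 + 12) (step [] ?d s3)"
    using exec_Assign_Seq[OF exec.Seq[OF e1 exec_Assign_Seq[OF exec.Seq[OF e2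
      exec_Assign_Seq[OF exec.Seq[OF e3 e4], of "Const 1"]], of "Const 0"]], of "Const 0"] z
    by (simp add: lookahead_matching_def eval_nat_numeral ac_simps)
  moreover have "k1 + k2 + k3 + k4 + 12 \<le> 60 * (n * n) + 60 * n + 60 * L + 300"
    using k1 k2 k3 k4 by (simp add: advance_def algebra_simps)
  ultimately show ?thesis
    using s3 K mt P unfolding run_init_def
    by (intro exI[of _ "k1 + k2 + k3 + k4 + 12"] exI[of _ "step [] ?d s3"]) simp
qed

section \<open>A fixed update stream: its graphs, touched edges and size bounds\<close>

locale lookahead_run =
  fixes n m L W :: nat and qs :: "update list"
  assumes n_pos: "0 < n"
    and valid: "\<forall>q\<in>set qs. valid_update n q"
    and m: "m = max_edges qs"
    and L: "2 ^ L \<le> max 1 m" "m < 2 * 2 ^ L"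
    and W: "2 * (n * n) + n + 2 < W"
begin

definition graph :: "nat \<Rightarrow> graph" where
  "graph i = graph_after (take i qs)"

text \<open>The default 0 pads the last batch to full length and agrees with what the program
  computes from lookahead reads beyond the end.\<close>

definition edge_at :: "nat \<Rightarrow> nat" where
  "edge_at t = (if t < length qs then code n (fst_of (qs ! t)) (snd_of (qs ! t)) else 0)"

lemma graph_0: "graph 0 = {}"
  by (simp add: graph_def graph_after_def)

lemma graph_Suc: "i < length qs \<Longrightarrow> graph (Suc i) = apply_update (qs ! i) (graph i)"
  by (simp add: graph_def graph_after_def take_Suc_conv_app_nth)

lemma ends: "i < length qs \<Longrightarrow> fst_of (qs ! i) < n \<and> snd_of (qs ! i) < n \<and> fst_of (qs ! i) \<noteq> snd_of (qs ! i)"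
  using valid by (cases "qs ! i") (force dest: nth_mem)+

lemma canonical_edge_at: "canonical n (edge_at t)"
  using ends[of t] canonical_code canonical_0[OF n_pos] by (simp add: edge_at_def)

lemma decode_edge_at: "i < length qs \<Longrightarrow> decode n (edge_at i) = {fst_of (qs ! i), snd_of (qs ! i)}"
  using ends[of i] decode_code by (simp add: edge_at_def)

lemma graph_Suc_iff:
  assumes "i < length qs"
  shows "e \<in> graph (Suc i) \<longleftrightarrow>
    (if e = decode n (edge_at i) then kind_of (qs ! i) = 1 else e \<in> graph i)"
  using decode_edge_at[OF assms] graph_Suc[OF assms] by (cases "qs ! i") auto

lemma simple_graph: "i \<le> length qs \<Longrightarrow> simple_graph n (graph i)"
proof (induction i)
  case 0
  then show ?case by (simp add: graph_0 simple_graph_def)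
next
  case (Suc i)
  then have "i < length qs" by simp
  from ends[OF this] decode_edge_at[OF this] graph_Suc_iff[OF this] Suc show ?case
    unfolding simple_graph_def by (metis Suc_leD)
qed

lemma card_graph: "i \<le> length qs \<Longrightarrow> card (graph i) \<le> m"
  unfolding m max_edges_def graph_def by (rule Max_ge) auto

lemma finite_graph: "i \<le> length qs \<Longrightarrow> finite (graph i)"
  by (rule finite_subset[of _ "Pow {..<n}"]) (use simple_graph[of i] in \<open>auto simp: simple_graph_def\<close>)

lemma graph_decode: "i \<le> length qs \<Longrightarrow> graph i \<subseteq> decode n ` {..<n * n}"
proof
  fix e assume "i \<le> length qs" "e \<in> graph i"
  then obtain u v where "e = {u, v}" "u \<noteq> v" "u < n" "v < n"
    using simple_graphE simple_graph by metis
  with decode_code canonical_code show "e \<in> decode n ` {..<n * n}"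
    by (metis canonical_def imageI lessThan_iff)
qed

lemma m_attained: "\<exists>i\<le>length qs. m = card (graph i)"
proof -
  have "m \<in> (\<lambda>i. card (graph_after (take i qs))) ` {..length qs}"
    unfolding m max_edges_def by (rule Max_in) auto
  then show ?thesis by (auto simp: graph_def)
qed

text \<open>Used for the word size: list positions, which go up to 2m, fit into a word.\<close>

lemma m_le: "m \<le> n * n"
proof -
  obtain i where i: "i \<le> length qs" "m = card (graph i)" using m_attained by auto
  have "card (graph i) \<le> card (decode n ` {..<n * n})"
    by (rule card_mono[OF _ graph_decode[OF i(1)]]) simp
  also have "\<dots> \<le> n * n" using card_image_le[of "{..<n * n}" "decode n"] by simp
  finally show ?thesis using i by simp
qed

text \<open>An update adds at most one edge to an initially empty graph. The bound lets the number
  of updates pay for an incomplete last batch.\<close>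

lemma m_le_length: "m \<le> length qs"
proof -
  have "card (graph i) \<le> i" if "i \<le> length qs" for i
    using that
  proof (induction i)
    case (Suc i)
    then have i: "i < length qs" by simp
    have "graph (Suc i) \<subseteq> insert (decode n (edge_at i)) (graph i)"
      by (auto simp: graph_Suc_iff[OF i] split: if_splits)
    then have "card (graph (Suc i)) \<le> card (insert (decode n (edge_at i)) (graph i))"
      by (rule card_mono[rotated]) (use finite_graph[of i] i in simp)
    also have "\<dots> \<le> Suc (card (graph i))" 
      using finite_graph[of i] i by (simp add: card_insert_if)
    finally show ?case using Suc by simp
  qed (simp add: graph_0)
  with m_attained show ?thesis by (metis le_trans)
qed

lemma W': "n < W" "n * n < W" "2 * m + 2 < W" "0 < W" "1 < W" "2 < W"
  using W m_le by simp_all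

end

lemma add_le_of_dvd: "x < y \<Longrightarrow> h dvd x \<Longrightarrow> h dvd y \<Longrightarrow> x + h \<le> (y :: nat)"
  using dvd_imp_le[of h "y - x"] by (simp add: dvd_diff_nat)

context lookahead_run
begin

definition base_inv :: "nat \<Rightarrow> state \<Rightarrow> bool" where
  "base_inv i s \<longleftrightarrow> reg s ''n'' = n \<and> reg s ''m'' = m \<and>
     represents n (graph i) (arr s ''P'') \<and> mates n (graph i) (arr s ''mt'') \<and>
     covers n (graph i) (arr s ''mt'') {}"

text \<open>The bound on \<open>len\<close> limits the cost of the next reload. That the list
  contains all present edges makes coverage outside the whole list trivial at a batch start.\<close>

definition list_inv :: "nat \<Rightarrow> state \<Rightarrow> bool" where
  "list_inv i s \<longleftrightarrow> reg s ''p'' = i mod 2 ^ L \<and> reg s ''K'' = 2 ^ L \<and> reg s ''len'' \<le> 2 * m \<and>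
     (\<forall>j<reg s ''len''. canonical n (arr s ''Q'' j)) \<and>
     graph i \<subseteq> decode n ` arr s ''Q'' ` {..<reg s ''len''}"

text \<open>
  Entries \<open>r, \<dots>, r + 2^L - 1\<close> of \<open>Q\<close> are the edges touched in the current batch of updates; they
  form the leaves of a binary tree whose node at height \<open>l\<close> above leaf \<open>p\<close> is \<open>block\<close>.
\<close>

definition block :: "nat \<Rightarrow> state \<Rightarrow> nat \<Rightarrow> edge set" where
  "block p s l = decode n ` arr s ''Q'' `
     {reg s ''r'' + (p - p mod 2 ^ l)..<reg s ''r'' + (p - p mod 2 ^ l) + 2 ^ l}"

text \<open>A level whose block length divides the position starts a new block there and is
  established while that position is served; coverage is therefore demanded only for blocks begun
  earlier.\<close>

definition batch_inv :: "nat \<Rightarrow> state \<Rightarrow> bool" where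
  "batch_inv i s \<longleftrightarrow> reg s ''len'' = reg s ''r'' + 2 ^ L \<and> reg s ''r'' \<le> m \<and>
     (\<forall>j<2 ^ L. arr s ''Q'' (reg s ''r'' + j) = edge_at (i - i mod 2 ^ L + j)) \<and>
     (\<forall>l\<le>L. \<not> 2 ^ l dvd i mod 2 ^ L \<longrightarrow>
        covers n (graph i) (arr s ''mt'') (block (i mod 2 ^ L) s l))"

text \<open>For m = 0 the graph stays empty and only the basic part matters; at a batch boundary the
  batch part is left to the reload.\<close>

definition invariant :: "nat \<Rightarrow> state \<Rightarrow> bool" where
  "invariant i s \<longleftrightarrow> base_inv i s \<and>
     (m > 0 \<longrightarrow> list_inv i s \<and> (i mod 2 ^ L \<noteq> 0 \<longrightarrow> batch_inv i s))"

lemma pow_le_m: "m > 0 \<Longrightarrow> 2 ^ L \<le> m"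
  using L(1) by (simp add: max_def split: if_splits)

lemma look_window:
  assumes "j < m"
  shows "look f (take m (drop i qs)) j = (if i + j < length qs then f (qs ! (i + j)) else 0)"
  using assms by (auto simp: look_def)

lemma look_ends: "look fst_of (take m (drop i qs)) j < n" "look snd_of (take m (drop i qs)) j < n"
  using ends[of "i + j"] n_pos by (auto simp: look_def)

lemma code_look: "j < m \<Longrightarrow>
  code n (look fst_of (take m (drop i qs)) j) (look snd_of (take m (drop i qs)) j) = edge_at (i + j)"
  by (simp add: look_window edge_at_def code_def)

text \<open>The list has at most 2m < 4 * 2^L entries, so the passes over it and over the new batch
  take O(2^L) time.\<close>

lemma exec_reload:
  assumes inv: "base_inv i s" "list_inv i s" and i: "i \<le> length qs" "i mod 2 ^ L = 0" and "m > 0"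
  shows "\<exists>k s'. exec W (take m (drop i qs)) reload_prog s k s' \<and> k \<le> 1000 * 2 ^ L \<and>
    base_inv i s' \<and> list_inv i s' \<and> batch_inv i s'"
proof -
  let ?w = "take m (drop i qs)" and ?Q = "arr s ''Q''" and ?P = "arr s ''P''"
  let ?len = "reg s ''len''"
  have K: "2 ^ L \<le> m" using pow_le_m \<open>m > 0\<close> by simp
  have len: "?len \<le> 2 * m" and can: "\<And>j. j < ?len \<Longrightarrow> canonical n (?Q j)"
    and sub: "graph i \<subseteq> decode n ` ?Q ` {..<?len}"
    using inv by (auto simp: list_inv_def)
  have lenW: "?len < W" using len W' by simp
  have QW: "?Q j < W" if "j < ?len" for j using can[OF that] W' by (simp add: canonical_def)
  obtain k1 s1 where e1: "exec W ?w (While (Op Less (Reg ''i'') (Reg ''len'')) clear_prog)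
      (set_reg ''i'' 0 s) k1 s1" and k1: "k1 \<le> (?len + 1) * 60"
    and mk1: "\<forall>j<?len. arr s1 ''mk'' (?Q j) = 0" and fr1: "frame clear_prog (set_reg ''i'' 0 s) s1"
    using exec_clear[of "set_reg ''i'' 0 s" ?len W ?w] lenW QW by auto
  have s1: "\<And>x. x \<noteq> ''i'' \<Longrightarrow> reg s1 x = reg s x" "\<And>a. a \<noteq> ''mk'' \<Longrightarrow> arr s1 a = arr s a"
    using frameD[OF fr1] by (simp_all add: clear_prog_def prog_defs)
  obtain k2 s2 r where e2: "exec W ?w (While (Op Less (Reg ''i'') (Reg ''len'')) compact_prog)
      (set_reg ''r'' 0 (set_reg ''i'' 0 s1)) k2 s2" and k2: "k2 \<le> (?len + 1) * 60"
    and r: "reg s2 ''r'' = r" "r \<le> ?len" "inj_on (arr s2 ''Q'') {..<r}"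
      "arr s2 ''Q'' ` {..<r} = {e \<in> ?Q ` {..<?len}. ?P e \<noteq> 0}"
    and fr2: "frame compact_prog (set_reg ''r'' 0 (set_reg ''i'' 0 s1)) s2"
    using exec_compact[of "set_reg ''r'' 0 (set_reg ''i'' 0 s1)" ?len W ?w] s1 lenW QW mk1 W' by auto
  have s2: "\<And>x. x \<notin> {''i'', ''e'', ''r''} \<Longrightarrow> reg s2 x = reg s x"
    "\<And>a. a \<notin> {''mk'', ''Q''} \<Longrightarrow> arr s2 a = arr s a"
    using frameD[OF fr2] s1 by (simp_all add: compact_prog_def prog_defs)
  have rep: "represents n (graph i) ?P" using inv by (simp add: base_inv_def)
  have new: "canonical n e \<and> decode n e \<in> graph i" if "e \<in> arr s2 ''Q'' ` {..<r}" for e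
  proof -
    from that obtain j where j: "j < ?len" "e = ?Q j" "?P e \<noteq> 0" unfolding r(4) by auto
    with can[OF j(1)] rep show ?thesis unfolding represents_def by metis
  qed
  \<comment> \<open>The kept codes are distinct and decode injectively to edges of the current
    graph.\<close>
  have rm: "r \<le> m"
  proof -
    have "inj_on (decode n) (arr s2 ''Q'' ` {..<r})"
      using new decode_inj by (intro inj_onI) blast
    then have "card (decode n ` arr s2 ''Q'' ` {..<r}) = r"
      using r(3) by (simp add: card_image)
    moreover have "card (decode n ` arr s2 ''Q'' ` {..<r}) \<le> card (graph i)"
      using new by (intro card_mono[OF finite_graph[OF i(1)]]) auto
    ultimately show ?thesis using card_graph[OF i(1)] by simp
  qed
  have nK: "reg s2 ''n'' = n" "reg s2 ''K'' = 2 ^ L"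
    using s2 inv by (simp_all add: base_inv_def list_inv_def)
  have rK: "r + 2 ^ L < W" using rm K W' by simp
  obtain k3 s3 where e3: "exec W ?w (While (Op Less (Reg ''i'') (Reg ''K'')) load_prog)
      (set_reg ''i'' 0 s2) k3 s3" and k3: "k3 \<le> (2 ^ L + 1) * 60"
    and Q3: "\<forall>j<r. arr s3 ''Q'' j = arr s2 ''Q'' j"
      "\<forall>j<2 ^ L. arr s3 ''Q'' (r + j) = code n (look fst_of ?w j) (look snd_of ?w j)"
    and fr3: "frame load_prog (set_reg ''i'' 0 s2) s3"
    using exec_load[of "set_reg ''i'' 0 s2" r "2 ^ L" W n ?w] r(1) nK rK W' look_ends by auto
  have s3: "\<And>x. x \<notin> {''i'', ''x'', ''y''} \<Longrightarrow> reg s3 x = reg s2 x"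
    "\<And>a. a \<noteq> ''Q'' \<Longrightarrow> arr s3 a = arr s2 a"
    using frameD[OF fr3] by (simp_all add: load_prog_def prog_defs)
  let ?s4 = "set_reg ''len'' (r + 2 ^ L) s3"
  have e4: "exec W ?w (Assign ''len'' (Op Add (Reg ''r'') (Reg ''K''))) s3 4 ?s4"
    using exec.Assign[of ?w s3 "Op Add (Reg ''r'') (Reg ''K'')" W "''len''"] s3 r(1) nK rK
    by (simp add: eval_nat_numeral)
  have "exec W ?w reload_prog s (k1 + k2 + k3 + 19) ?s4"
    unfolding reload_prog_def
    using exec_Assign_Seq[OF exec.Seq[OF e1 exec_Assign_Seq[OF exec_Assign_Seq[OF exec.Seq[OF e2
      exec_Assign_Seq[OF exec.Seq[OF e3 e4], of "Const 0"]], of "Const 0"], of "Const 0"]],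
      of "Const 0"] W'(4) by (simp add: eval_nat_numeral ac_simps)
  moreover have "k1 + k2 + k3 + 19 \<le> 1000 * 2 ^ L"
  proof -
    define K where "K = (2::nat) ^ L"
    have "1 \<le> K" "k3 \<le> 60 * K + 60" "m < 2 * K" using k3 L(2) by (simp_all add: K_def)
    moreover have "k1 \<le> 120 * m + 60" "k2 \<le> 120 * m + 60" using k1 k2 len by simp_all
    ultimately have "k1 + k2 + k3 + 19 \<le> 1000 * K" by linarith
    then show ?thesis by (simp add: K_def)
  qed
  moreover have "base_inv i ?s4"
    using inv s3 s2 by (simp add: base_inv_def)
  \<comment> \<open>The coverage clause is vacuous, since every power of two divides position
    0.\<close>
  moreover have "batch_inv i ?s4"
    unfolding batch_inv_def
    using s3 r(1) rm Q3(2) code_look[of _ i] K i(2) by auto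
  moreover have "list_inv i ?s4"
    unfolding list_inv_def
  proof (intro conjI allI impI)
    show "reg ?s4 ''p'' = i mod 2 ^ L" "reg ?s4 ''K'' = 2 ^ L"
      using s3 s2 inv by (simp_all add: list_inv_def)
    show "reg ?s4 ''len'' \<le> 2 * m" using rm K by simp
    show "canonical n (arr ?s4 ''Q'' j)" if "j < reg ?s4 ''len''" for j
    proof (cases "j < r")
      case True
      then show ?thesis using Q3(1) new by simp
    next
      case False
      then have "j = r + (j - r)" "j - r < 2 ^ L" using that by simp_all
      then have "arr ?s4 ''Q'' j = edge_at (i + (j - r))"
        using Q3(2) code_look[of "j - r" i] K by (metis arr_set_reg less_le_trans)
      then show ?thesis using canonical_edge_at by simp
    qed
    show "graph i \<subseteq> decode n ` arr ?s4 ''Q'' ` {..<reg ?s4 ''len''}"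
    proof
      fix e assume e: "e \<in> graph i"
      with sub obtain j where j: "j < ?len" "e = decode n (?Q j)" by auto
      with e rep can[OF j(1)] have "?P (?Q j) \<noteq> 0" by (simp add: represents_def)
      with j have "?Q j \<in> arr s2 ''Q'' ` {..<r}" unfolding r(4) by simp
      then obtain j' where "j' < r" "arr s2 ''Q'' j' = ?Q j" by auto
      then have "arr ?s4 ''Q'' j' = ?Q j" "j' < reg ?s4 ''len''" using Q3(1) by simp_all
      with j(2) show "e \<in> decode n ` arr ?s4 ''Q'' ` {..<reg ?s4 ''len''}"
        by (intro image_eqI[of e "decode n" "?Q j"] image_eqI[of _ _ j']) simp_all
    qed
  qed
  ultimately show ?thesis
    by (intro exI[of _ "k1 + k2 + k3 + 19"] exI[of _ ?s4] conjI)
qed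

text \<open>The exponent \<open>j\<close> is returned because the amortization charges the cost to
  level \<open>j\<close>; the clause \<open>j = L\<close> at a batch start allows the reload to be
  charged there as well.\<close>

lemma exec_serve:
  assumes inv: "base_inv i s" "list_inv i s" "batch_inv i s" and i: "i < length qs" and "m > 0"
  shows "\<exists>k s' j. exec W (take m (drop i qs)) serve_prog s k s' \<and> j \<le> L \<and> 2 ^ j dvd i \<and>
    (i mod 2 ^ L = 0 \<longrightarrow> j = L) \<and> k \<le> 2000 * 2 ^ j \<and> invariant (Suc i) s'"
proof -
  let ?w = "take m (drop i qs)" and ?Q = "arr s ''Q''" and ?r = "reg s ''r''"
  define p where "p = i mod 2 ^ L"
  have K: "2 ^ L \<le> m" using pow_le_m \<open>m > 0\<close> by simp
  have pK: "p < 2 ^ L" by (simp add: p_def)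
  have s: "reg s ''n'' = n" "reg s ''m'' = m" "reg s ''p'' = p" "reg s ''K'' = 2 ^ L"
    "reg s ''len'' = ?r + 2 ^ L"
    using inv by (simp_all add: base_inv_def list_inv_def batch_inv_def p_def)
  have r: "?r \<le> m" using inv by (simp add: batch_inv_def)
  have Qp: "?Q (?r + p) = edge_at i"
    using inv(3) pK by (simp add: batch_inv_def p_def)
  have look0: "look fst_of ?w 0 = fst_of (qs ! i)" "look snd_of ?w 0 = snd_of (qs ! i)"
    "look kind_of ?w 0 = kind_of (qs ! i)" "code n (fst_of (qs ! i)) (snd_of (qs ! i)) = edge_at i"
    using look_window[OF \<open>m > 0\<close>, of _ i] i by (simp_all add: edge_at_def)
  have eW: "edge_at i < W" using canonical_edge_at[of i] W' by (simp add: canonical_def)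
  define s1 where "s1 = step ?w apply_prog s"
  have "safe W ?w apply_prog s"
    using s look0 ends[OF i] eW W' by (simp add: apply_prog_def eval_code_exp)
  then obtain k1 where e1: "exec W ?w apply_prog s k1 s1" and k1: "k1 \<le> 60"
    using exec_step[of W ?w apply_prog s]
    by (auto simp: s1_def apply_prog_def code_exp_def)
  have s1: "\<And>x. x \<notin> {''x'', ''y'', ''e'', ''h''} \<Longrightarrow> reg s1 x = reg s x"
    "\<And>a. a \<noteq> ''P'' \<Longrightarrow> arr s1 a = arr s a" "reg s1 ''h'' = 1"
    "arr s1 ''P'' = (arr s ''P'')(edge_at i := if kind_of (qs ! i) = 1 then 1 else 0)"
    using s look0 by (simp_all add: s1_def apply_prog_def eval_code_exp)
  have rep: "represents n (graph (Suc i)) (arr s1 ''P'')"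
    using inv(1) canonical_edge_at[of i] decode_inj[of n]
    unfolding represents_def s1(4) graph_Suc_iff[OF i] base_inv_def by auto
  obtain k2 s2 j where e2: "exec W ?w (While double_cond double_prog) s1 k2 s2"
    and j: "j \<le> L" "k2 \<le> (j + 1) * 60" "reg s2 ''h'' = 2 ^ j" "2 ^ j dvd p"
      "j < L \<longrightarrow> \<not> 2 ^ Suc j dvd p"
    and fr2: "frame double_prog s1 s2"
    using exec_double[of s1 p L W ?w] s1 s K W' by auto
  have s2: "\<And>x. x \<notin> {''x'', ''y'', ''e'', ''h''} \<Longrightarrow> reg s2 x = reg s x"
    "\<And>a. a \<noteq> ''P'' \<Longrightarrow> arr s2 a = arr s a" "arr s2 ''P'' = arr s1 ''P''"
    using frameD[OF fr2] s1 by (simp_all add: double_prog_def)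
  define h where "h = (2::nat) ^ j"
  have h1: "1 \<le> h" by (simp add: h_def)
  have hK: "h dvd 2 ^ L" using j(1) by (simp add: h_def le_imp_power_dvd)
  have hp: "h dvd p" using j by (simp add: h_def)
  have phK: "p + h \<le> 2 ^ L" using add_le_of_dvd[OF pK hp hK] .
  have p0: "h \<le> p" "j < L" if "p \<noteq> 0"
    using that hp pK j(1,4) dvd_imp_le[of "2 ^ L" p] dvd_imp_le[of h p]
    by (auto simp: h_def le_less)
  have jL: "j = L" if "p = 0" using that j by auto
  define a where "a = ?r + p"
  define b where "b = a + h"
  define lo where "lo = (if p = 0 then 0 else a - h)"
  define hi where "hi = (if p = 0 then ?r + 2 ^ L else b)"
  have ranges: "lo \<le> a" "a \<le> b" "a < b" "b \<le> hi" "hi \<le> ?r + 2 ^ L" "hi < W" "b < W" "lo < W" "a < W"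
    using phK r K W' h1 by (auto simp: a_def b_def lo_def hi_def)
  define s3 where "s3 = step ?w range_prog s2"
  have rW: "?r + 2 ^ L < W" "?r + p + 2 ^ j < W" "?r + p < W"
    using r K W' ranges by (simp_all add: a_def b_def h_def)
  then have "?r + p - 2 ^ j < W" by simp
  with rW have safe3: "safe W ?w range_prog s2"
    using s s2 j(3) W' by (simp add: range_prog_def)
  obtain k3 where e3: "exec W ?w range_prog s2 k3 s3" and "k3 \<le> max_cost range_prog"
    unfolding s3_def using exec_step[OF safe3] by blast
  then have k3: "k3 \<le> 60" by (simp add: range_prog_def)
  have s3: "\<And>x. x \<notin> {''x'', ''y'', ''e'', ''h'', ''a'', ''b'', ''lo'', ''hi''} \<Longrightarrow> reg s3 x = reg s x"
    "\<And>a. a \<noteq> ''P'' \<Longrightarrow> arr s3 a = arr s a" "arr s3 ''P'' = arr s1 ''P''"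
    "reg s3 ''lo'' = lo" "reg s3 ''hi'' = hi" "reg s3 ''a'' = a" "reg s3 ''b'' = b"
    using s s2 j(3) by (simp_all add: s3_def range_prog_def a_def b_def lo_def hi_def h_def)
  define X where "X = decode n ` ?Q ` {lo..<hi}"
  let ?mt = "arr s ''mt''"
  have eX: "decode n (edge_at i) \<in> X"
    unfolding X_def using Qp ranges by (force simp: a_def)
  have can: "canonical n (?Q j)" if "j < ?r + 2 ^ L" for j
    using inv(2) that s(5) by (simp add: list_inv_def)
  have cov: "covers n (graph i) ?mt (block p s l)" if "l \<le> L" "\<not> 2 ^ l dvd p" for l
    using inv(3) that by (simp add: batch_inv_def p_def)
  \<comment> \<open>At p = 0 all present edges lie in \<open>X\<close>. Otherwise \<open>X\<close>
    is the block of level j+1, which began before \<open>p\<close>, so the invariant provides its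
    coverage.\<close>
  have covX: "covers n (graph i) ?mt X"
  proof (cases "p = 0")
    case True
    have "graph i \<subseteq> X"
      using inv(2) s(5) True by (simp add: list_inv_def X_def lo_def hi_def lessThan_atLeast0)
    then show ?thesis by (auto simp: covers_def)
  next
    case False
    note p0 = p0[OF False]
    have "\<not> 2 ^ Suc j dvd p" using j(5) p0 by simp
    moreover obtain q where q: "p = h * q" using hp by auto
    \<comment> \<open>By maximality of \<open>j\<close>; hence \<open>p\<close> is the middle of its
      block of length 2h, which starts at \<open>p - h\<close>.\<close>
    ultimately have "odd q" by (auto simp: h_def)
    then have "p mod 2 ^ Suc j = h"
      unfolding q using mult_mod_right[of h q 2] by (simp add: h_def mult.commute odd_iff_mod_2_eq_one)
    then have "block p s (Suc j) = X"
      using False p0 by (simp add: block_def X_def lo_def hi_def a_def b_def h_def ac_simps)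
    with cov[of "Suc j"] p0 \<open>\<not> 2 ^ Suc j dvd p\<close> show ?thesis by simp
  qed
  obtain k4 s4 where e4: "exec W ?w rematch_prog s3 k4 s4"
    and k4: "k4 \<le> 240 * (hi - lo) + 300"
    and mt4: "mates n (graph (Suc i)) (arr s4 ''mt'')"
      "\<And>Y. X \<subseteq> Y \<Longrightarrow> covers n (graph i) ?mt Y \<Longrightarrow> covers n (graph (Suc i)) (arr s4 ''mt'') Y"
      "\<And>j. a \<le> j \<Longrightarrow> j \<le> b \<Longrightarrow>
        covers n (graph (Suc i)) (arr s4 ''mt'') (decode n ` ?Q ` {a..<j})"
  proof -
    have "\<forall>e. e \<notin> X \<longrightarrow> (e \<in> graph i \<longleftrightarrow> e \<in> graph (Suc i))"
      using eX graph_Suc_iff[OF i] by auto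
    moreover have "mates n (graph i) ?mt" using inv(1) by (simp add: base_inv_def)
    moreover have "simple_graph n (graph (Suc i))" using simple_graph i by simp
    moreover have "arr s3 ''mt'' = ?mt" "arr s3 ''Q'' = ?Q" "reg s3 ''n'' = n"
      using s3 s by simp_all
    moreover have "canonical n (?Q j)" if "lo \<le> j" "j < hi" for j
      using can that ranges by simp
    ultimately have "\<exists>k s'. exec W ?w rematch_prog s3 k s' \<and> k \<le> 240 * (hi - lo) + 300 \<and>
        mates n (graph (Suc i)) (arr s' ''mt'') \<and>
        (\<forall>Y. X \<subseteq> Y \<longrightarrow> covers n (graph i) ?mt Y \<longrightarrow> covers n (graph (Suc i)) (arr s' ''mt'') Y) \<and>
        (\<forall>j. a \<le> j \<longrightarrow> j \<le> b \<longrightarrow>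
          covers n (graph (Suc i)) (arr s' ''mt'') (decode n ` ?Q ` {a..<j}))"
      using exec_rematch[of s3 n W lo hi a b X "graph i" "graph (Suc i)" ?w]
        s3(3-7) ranges W' covX rep X_def by simp
    then show ?thesis using that by blast
  qed
  have s4: "\<And>x. x \<notin> {''x'', ''y'', ''e'', ''h'', ''a'', ''b'', ''lo'', ''hi'', ''i''} \<Longrightarrow> reg s4 x = reg s x"
    "\<And>a. a \<notin> {''P'', ''mk'', ''mt''} \<Longrightarrow> arr s4 a = arr s a" "arr s4 ''P'' = arr s1 ''P''"
    using frameD[OF exec_frame[OF e4]] s3
    by (simp_all add: rematch_prog_def for_up_def for_down_def unmatch_prog_def mark_prog_def
        match_unmarked_prog_def match_marked_prog_def match_prog_def prog_defs)
  define s5 where "s5 = step ?w next_prog s4"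
  have safe5: "safe W ?w next_prog s4"
    using s s4 pK K W' by (simp add: next_prog_def)
  obtain k5 where e5: "exec W ?w next_prog s4 k5 s5" and "k5 \<le> max_cost next_prog"
    unfolding s5_def using exec_step[OF safe5] by blast
  then have k5: "k5 \<le> 60" by (simp add: next_prog_def)
  have p': "Suc i mod 2 ^ L = (if Suc p = 2 ^ L then 0 else Suc p)"
    by (simp add: mod_Suc p_def)
  have s5: "\<And>x. x \<notin> {''x'', ''y'', ''e'', ''h'', ''a'', ''b'', ''lo'', ''hi'', ''i'', ''p''} \<Longrightarrow> reg s5 x = reg s x"
    "arr s5 = arr s4" "reg s5 ''p'' = Suc i mod 2 ^ L"
    using s s4 p' by (simp_all add: s5_def next_prog_def)
  have "base_inv (Suc i) s5"
    using s5 s4 s rep mt4(1) mt4(3)[of a] ranges by (simp add: base_inv_def)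
  moreover have "list_inv (Suc i) s5"
    unfolding list_inv_def
  proof (intro conjI)
    show "graph (Suc i) \<subseteq> decode n ` arr s5 ''Q'' ` {..<reg s5 ''len''}"
    proof
      fix e assume "e \<in> graph (Suc i)"
      then consider "e = decode n (?Q (?r + p))" | "e \<in> graph i"
        using graph_Suc_iff[OF i] Qp by (auto split: if_splits)
      then have "e \<in> decode n ` ?Q ` {..<?r + 2 ^ L}"
      proof cases
        case 1
        then show ?thesis using pK by (auto intro!: imageI)
      next
        case 2
        then show ?thesis using inv(2) s(5) by (auto simp: list_inv_def)
      qed
      then show "e \<in> decode n ` arr s5 ''Q'' ` {..<reg s5 ''len''}" using s5 s4 s by simp
    qed
  qed (use s5 s4 s r K can in auto)
  moreover have "batch_inv (Suc i) s5" if ne: "Suc i mod 2 ^ L \<noteq> 0"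
  proof -
    have p'': "Suc i mod 2 ^ L = Suc p" using p' ne by (simp split: if_splits)
    have "Suc i - Suc p = i - p" by simp
    moreover have "covers n (graph (Suc i)) (arr s5 ''mt'') (block (Suc p) s5 l)"
      if l: "l \<le> L" "\<not> 2 ^ l dvd Suc p" for l
    proof -
      \<comment> \<open>Position p+1 does not start a block of level \<open>l\<close>, so it shares
        this block with \<open>p\<close>.\<close>
      have "Suc p mod 2 ^ l = Suc (p mod 2 ^ l)"
        using l(2) by (simp add: mod_Suc dvd_eq_mod_eq_0 split: if_splits)
      then have "block (Suc p) s5 l = block p s l"
        using s5 s4 by (simp add: block_def)
      moreover have "covers n (graph (Suc i)) (arr s4 ''mt'') (block p s l)"
      proof (cases "l \<le> j")
        \<comment> \<open>A level up to \<open>j\<close>: the block starts at \<open>p\<close> and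
          is one of the prefixes just renewed.\<close>
        case True
        then have "(2::nat) ^ l dvd h" by (simp add: h_def le_imp_power_dvd)
        then have "2 ^ l \<le> h" and "2 ^ l dvd p"
          using dvd_imp_le[of "2 ^ l" h] dvd_trans[of "2 ^ l" h p] hp h1 by simp_all
        from this(2) have "block p s l = decode n ` ?Q ` {a..<a + 2 ^ l}"
          by (simp add: block_def a_def)
        then show ?thesis
          using mt4(3)[of "a + 2 ^ l"] \<open>2 ^ l \<le> h\<close> by (simp add: b_def)
      next
        \<comment> \<open>A level above \<open>j\<close>: the offset of \<open>p\<close> in its
          block is a positive multiple of \<open>h\<close> and leaves at least \<open>h\<close>
          positions, so the block contains \<open>X\<close> and keeps its coverage.\<close>
        case False
        then have "p \<noteq> 0" using jL l(1) by (intro notI) simp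
        have "h dvd 2 ^ l" using False by (simp add: h_def le_imp_power_dvd)
        then have hx: "h dvd p mod 2 ^ l" using hp by (simp add: dvd_mod)
        have nd: "\<not> 2 ^ l dvd p"
        proof
          assume "2 ^ l dvd p"
          have "(2::nat) ^ Suc j dvd 2 ^ l" using False by (intro le_imp_power_dvd) simp
          then have "2 ^ Suc j dvd p" using \<open>2 ^ l dvd p\<close> by (rule dvd_trans)
          with j(5) p0(2)[OF \<open>p \<noteq> 0\<close>] show False by simp
        qed
        then have "0 < p mod 2 ^ l" by (simp add: dvd_eq_mod_eq_0)
        then have "h \<le> p mod 2 ^ l" using hx by (rule dvd_imp_le[rotated])
        moreover have "p mod 2 ^ l + h \<le> 2 ^ l"
          using add_le_of_dvd[OF _ hx \<open>h dvd 2 ^ l\<close>] by simp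
        moreover have "p mod 2 ^ l \<le> p" by simp
        ultimately have "X \<subseteq> block p s l"
          unfolding X_def block_def using \<open>p \<noteq> 0\<close>
          by (intro image_mono) (auto simp: lo_def hi_def a_def b_def)
        then show ?thesis using cov[OF l(1) nd] by (rule mt4(2))
      qed
      ultimately show ?thesis using s5 by simp
    qed
    moreover have "i mod 2 ^ L = p" by (simp add: p_def)
    ultimately show ?thesis
      using inv(3) s5 s4 unfolding batch_inv_def p'' by simp
  qed
  ultimately have "invariant (Suc i) s5" by (simp add: invariant_def)
  moreover have "exec W ?w serve_prog s (k1 + k2 + k3 + k4 + k5 + 4) s5"
    unfolding serve_prog_def
    using exec.Seq[OF e1 exec.Seq[OF e2 exec.Seq[OF e3 exec.Seq[OF e4 e5]]]]
    by (simp add: eval_nat_numeral ac_simps)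
  moreover have "k1 + k2 + k3 + k4 + k5 + 4 \<le> 2000 * 2 ^ j"
  proof -
    have "j + 1 \<le> h" unfolding h_def by (metis Suc_eq_plus1 Suc_leI less_exp)
    \<comment> \<open>At a batch start the range has \<open>r + 2^L\<close> entries with
      \<open>r <= m < 2 * 2^L\<close> and \<open>h = 2^L\<close>; elsewhere it has length
      2h.\<close>
    moreover have "hi - lo \<le> 3 * h"
    proof (cases "p = 0")
      case True
      then show ?thesis using jL r L(2) by (simp add: lo_def hi_def h_def)
    next
      case False
      then show ?thesis using p0 by (simp add: lo_def hi_def b_def)
    qed
    ultimately have "k2 \<le> 60 * h" "k4 \<le> 720 * h + 300" using j(2) k4 by simp_all
    then have "k1 + k2 + k3 + k4 + k5 + 4 \<le> 2000 * h" using k1 k3 k5 h1 by linarith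
    then show ?thesis by (simp add: h_def)
  qed
  moreover have "2 ^ j dvd i"
  proof -
    have "(2::nat) ^ j dvd 2 ^ L" using hK by (simp add: h_def)
    then show ?thesis using j(4) unfolding p_def by (simp add: dvd_mod_iff)
  qed
  ultimately show ?thesis using j(1) jL p_def
    by (intro exI[of _ "k1 + k2 + k3 + k4 + k5 + 4"] exI[of _ s5] exI[of _ j]) simp
qed

end

context lookahead_run
begin

lemma invariant_set_reg:
  "x \<in> {''u'', ''mate''} \<Longrightarrow> invariant i (set_reg x v s) \<longleftrightarrow> invariant i s"
  by (elim insertE emptyE)
    (simp_all add: invariant_def base_inv_def list_inv_def batch_inv_def block_def)

lemma invariant_0:
  assumes "reg s ''n'' = n" "reg s ''m'' = m" "reg s ''K'' = 2 ^ L" "reg s ''p'' = 0"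
    "reg s ''len'' = 0" "\<forall>e<n * n. arr s ''P'' e = 0" "\<forall>u<n. arr s ''mt'' u = n"
  shows "invariant 0 s"
  using assms by (simp add: invariant_def base_inv_def list_inv_def graph_0 represents_def
      canonical_def mates_def covers_def)

lemma exec_update:
  assumes inv: "invariant i s" and i: "i < length qs"
  shows "\<exists>k s' j. exec W (take m (drop i qs)) (update_prog lookahead_matching) s k s' \<and>
    j \<le> L \<and> 2 ^ j dvd i \<and> k \<le> 4000 * 2 ^ j \<and> invariant (Suc i) s'"
proof -
  let ?w = "take m (drop i qs)" and ?s = "set_reg ''mate'' 0 (set_reg ''u'' 0 s)"
  have inv': "invariant i ?s" using inv by (simp add: invariant_set_reg)
  have rm: "reg ?s ''m'' = m" using inv' by (simp add: invariant_def base_inv_def)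
  let ?c = "Seq (If (Reg ''p'') Skip reload_prog) serve_prog"
  have *: "exec W ?w (update_prog lookahead_matching) s (k + 6) s'"
    if "exec W ?w (If (Reg ''m'') ?c Skip) ?s k s'" for k s'
    using exec_Assign_Seq[OF exec_Assign_Seq[OF that, of "Const 0"], of "Const 0"] W'
    by (simp add: lookahead_matching_def eval_nat_numeral)
  show ?thesis
  proof (cases "m = 0")
    case True
    have "exec W ?w (If (Reg ''m'') ?c Skip) ?s 3 ?s"
      using exec.IfFalse[OF _ exec.Skip, of ?w ?s "Reg ''m''" W ?c] rm True
      by (simp add: eval_nat_numeral)
    from *[OF this] have "exec W ?w (update_prog lookahead_matching) s 9 ?s" by simp
    \<comment> \<open>With m = 0 every graph of the run is empty, so doing nothing preserves the
      invariant.\<close>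
    moreover have "graph i = {}" "graph (Suc i) = {}"
      using card_graph[of i] card_graph[of "Suc i"] finite_graph[of i] finite_graph[of "Suc i"] i True
      by simp_all
    then have "base_inv (Suc i) ?s"
      using inv' unfolding invariant_def base_inv_def by simp
    then have "invariant (Suc i) ?s"
      using True unfolding invariant_def by simp
    ultimately show ?thesis
      by (intro exI[of _ 9] exI[of _ ?s] exI[of _ 0]) simp
  next
    case False
    then have m: "m > 0" by simp
    have b: "base_inv i ?s" "list_inv i ?s" using inv' m by (simp_all add: invariant_def)
    have p: "reg ?s ''p'' = i mod 2 ^ L" using b by (simp add: list_inv_def)
    have "\<exists>k s'. exec W ?w (If (Reg ''p'') Skip reload_prog) ?s k s' \<and>
      k \<le> (if i mod 2 ^ L = 0 then 1002 * 2 ^ L else 3) \<and>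
      base_inv i s' \<and> list_inv i s' \<and> batch_inv i s'"
    proof (cases "i mod 2 ^ L = 0")
      case True
      obtain k s' where k: "exec W ?w reload_prog ?s k s'" "k \<le> 1000 * 2 ^ L"
        "base_inv i s' \<and> list_inv i s' \<and> batch_inv i s'"
        using exec_reload[OF b less_imp_le[OF i] True m] by blast
      have "exec W ?w (If (Reg ''p'') Skip reload_prog) ?s (k + 2) s'"
        using exec.IfFalse[OF _ k(1), of "Reg ''p''" Skip] p True by (simp add: eval_nat_numeral)
      moreover have "1 \<le> (2::nat) ^ L" by simp
      then have "k + 2 \<le> 1002 * 2 ^ L" using k(2) by linarith
      ultimately show ?thesis using k(3) True by (intro exI[of _ "k + 2"] exI[of _ s']) simp
    next
      case False
      have "exec W ?w (If (Reg ''p'') Skip reload_prog) ?s 3 ?s"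
        using exec.IfTrue[OF _ exec.Skip, of ?w ?s "Reg ''p''" W reload_prog] p False
        by (simp add: eval_nat_numeral)
      then show ?thesis using inv' m False b
        by (intro exI[of _ 3] exI[of _ ?s]) (simp add: invariant_def)
    qed
    then obtain k1 s1 where e1: "exec W ?w (If (Reg ''p'') Skip reload_prog) ?s k1 s1"
      and k1: "k1 \<le> (if i mod 2 ^ L = 0 then 1002 * 2 ^ L else 3)"
      and inv1: "base_inv i s1" "list_inv i s1" "batch_inv i s1" by blast
    obtain k2 s2 j where e2: "exec W ?w serve_prog s1 k2 s2" and j: "j \<le> L" "2 ^ j dvd i"
      "i mod 2 ^ L = 0 \<longrightarrow> j = L" and k2: "k2 \<le> 2000 * 2 ^ j" and inv2: "invariant (Suc i) s2"
      using exec_serve[OF inv1 i m] by (elim exE conjE) (rule that)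
    have "exec W ?w ?c ?s (1 + k1 + k2) s2" using e1 e2 by (rule exec.Seq)
    moreover have "eval ?w ?s (Reg ''m'') \<noteq> 0" using rm m by simp
    ultimately have "exec W ?w (If (Reg ''m'') ?c Skip) ?s (1 + exp_cost (Reg ''m'') + (1 + k1 + k2)) s2"
      by (intro exec.IfTrue)
    moreover have "1 + exp_cost (Reg ''m'') + (1 + k1 + k2) + 6 = k1 + k2 + 9" by simp
    ultimately have "exec W ?w (update_prog lookahead_matching) s (k1 + k2 + 9) s2"
      using * by metis
    moreover have "k1 + k2 + 9 \<le> 4000 * 2 ^ j"
    proof -
      have one: "1 \<le> (2::nat) ^ j" by simp
      have "k1 \<le> 1002 * 2 ^ j"
      proof (cases "i mod 2 ^ L = 0")
        case True
        then show ?thesis using k1 j(3) by simp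
      next
        case False
        then have "k1 \<le> 3" using k1 by simp
        then show ?thesis using one by linarith
      qed
      then show ?thesis using k2 one by linarith
    qed
    ultimately show ?thesis using j inv2
      by (intro exI[of _ "k1 + k2 + 9"] exI[of _ s2] exI[of _ j]) simp
  qed
qed

end

section \<open>Amortization over the levels\<close>

lemma sum_multiples_le: "(\<Sum>i<t. if d dvd i then d else 0) \<le> t + (d :: nat)"
proof (cases "d = 0")
  case False
  have "{i. i < t \<and> d dvd i} \<subseteq> (\<lambda>k. d * k) ` {..t div d}"
  proof
    fix i assume "i \<in> {i. i < t \<and> d dvd i}"
    then have i: "i < t" "d dvd i" by simp_all
    then have "i div d \<le> t div d" by (intro div_le_mono) simp
    with i(2) show "i \<in> (\<lambda>k. d * k) ` {..t div d}"
      by (intro image_eqI[of _ _ "i div d"]) simp_all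
  qed
  then have "card {i. i < t \<and> d dvd i} \<le> Suc (t div d)"
    using surj_card_le[of "{..t div d}"] by fastforce
  moreover have "(\<Sum>i<t. if d dvd i then d else 0) = d * card {i. i < t \<and> d dvd i}"
    by (simp add: sum.If_cases Int_def lessThan_def)
  ultimately have "(\<Sum>i<t. if d dvd i then d else 0) \<le> d * Suc (t div d)"
    by (metis mult_le_mono2)
  also have "\<dots> \<le> t + d" by simp
  finally show ?thesis .
qed simp

text \<open>
  A cost proportional to a power \<open>2^j\<close> dividing the time is charged to level \<open>j\<close>, and each level
  receives a constant charge per update.
\<close>

lemma sum_levels_le:
  fixes f :: "nat \<Rightarrow> nat"
  assumes "\<And>i. i < t \<Longrightarrow> \<exists>j\<le>L. 2 ^ j dvd i \<and> f i \<le> c * 2 ^ j"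
  shows "(\<Sum>i<t. f i) \<le> c * (Suc L * (t + 2 ^ L))"
proof -
  have "(\<Sum>i<t. f i) \<le> (\<Sum>i<t. c * (\<Sum>l\<le>L. if 2 ^ l dvd i then 2 ^ l else 0))"
  proof (rule sum_mono)
    fix i assume "i \<in> {..<t}"
    then obtain j where j: "j \<le> L" "2 ^ j dvd i" "f i \<le> c * 2 ^ j" using assms by auto
    \<comment> \<open>The charge at level \<open>j\<close> alone already pays for
      \<open>f i\<close>; summing over all levels removes the dependence of \<open>j\<close> on
      \<open>i\<close>.\<close>
    have "(if 2 ^ j dvd i then 2 ^ j else 0) \<le> (\<Sum>l\<le>L. if 2 ^ l dvd i then 2 ^ l else (0::nat))"
      by (rule member_le_sum) (use j in auto)
    then have "c * 2 ^ j \<le> c * (\<Sum>l\<le>L. if 2 ^ l dvd i then 2 ^ l else 0)"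
      using j(2) by (intro mult_le_mono2) simp
    with j(3) show "f i \<le> c * (\<Sum>l\<le>L. if 2 ^ l dvd i then 2 ^ l else 0)"
      by (rule order_trans)
  qed
  also have "\<dots> = c * (\<Sum>l\<le>L. \<Sum>i<t. if 2 ^ l dvd i then 2 ^ l else 0)"
    by (subst sum.swap) (simp add: sum_distrib_left)
  also have "\<dots> \<le> c * (\<Sum>l\<le>L. t + 2 ^ L)"
  proof (intro mult_left_mono sum_mono)
    fix l assume "l \<in> {..L}"
    then have "(2::nat) ^ l \<le> 2 ^ L" by (intro power_increasing) simp_all
    with sum_multiples_le[of "2 ^ l" t]
    show "(\<Sum>i<t. if 2 ^ l dvd i then 2 ^ l else 0) \<le> t + 2 ^ L" by linarith
  qed simp
  finally show ?thesis by simp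
qed

section \<open>Interleaving queries with a query-free run\<close>

lemma exec_update_cong:
  assumes "exec W w (update_prog lookahead_matching) t k s'"
    "set_reg ''mate'' 0 (set_reg ''u'' 0 s) = set_reg ''mate'' 0 (set_reg ''u'' 0 t)"
  shows "exec W w (update_prog lookahead_matching) s k s'"
proof -
  obtain c where c: "update_prog lookahead_matching =
      Seq (Assign ''u'' (Const 0)) (Seq (Assign ''mate'' (Const 0)) c)"
    by (simp add: lookahead_matching_def)
  from assms(1) obtain k1 k2 where W: "0 < W"
    and k: "exec W w c (set_reg ''mate'' 0 (set_reg ''u'' 0 t)) k2 s'" "k = k2 + 6"
    unfolding c by (auto elim!: SeqE AssignE)
  show ?thesis
    unfolding c k(2) using exec_Assign_Seq[OF exec_Assign_Seq[OF k(1)[folded assms(2)], of "Const 0"],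
      of "Const 0"] W by (simp add: eval_nat_numeral)
qed

text \<open>\<open>st\<close> and \<open>ks\<close> are the states and costs of the updates alone.
  Queries change only the registers \<open>u\<close> and \<open>mate\<close>, which each update
  resets before doing anything else, so the actual state always agrees with \<open>st i\<close> up
  to these two, whatever is asked.\<close>

lemma run_events_lookahead:
  assumes st: "\<And>i. i < length qs \<Longrightarrow>
      exec W (take m (drop i qs)) (update_prog lookahead_matching) (st i) (ks i) (st (Suc i))"
    and G: "\<And>i. i \<le> length qs \<Longrightarrow> mates n (G i) (arr (st i) ''mt'')"
    and n: "n < W"
    and es: "updates es = drop i qs" "i \<le> length qs" "\<And>u. Mate u \<in> set es \<Longrightarrow> u < n"
    and s: "set_reg ''mate'' 0 (set_reg ''u'' 0 s) = set_reg ''mate'' 0 (set_reg ''u'' 0 (st i))"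
  shows "\<exists>tr. run_events W lookahead_matching m s es tr \<and>
    (\<Sum>(e, k, s)\<leftarrow>filter (\<lambda>(e, k, s). is_update e) tr. k) = (\<Sum>j = i..<length qs. ks j) \<and>
    length (filter (\<lambda>(e, k, s). is_update e) tr) = length qs - i \<and>
    (\<forall>j<length tr. \<forall>u k s. tr ! j = (Mate u, k, s) \<longrightarrow> answer n s =
       mate (edges_of n (arr (st (i + length (updates (map fst (take j tr))))) ''mt'')) u \<and> k \<le> 3)"
proof -
  \<comment> \<open>The claim about the trace of the events remaining after \<open>i\<close>
    updates, isolated so that it can be extended by one event at a time.\<close>
  define R where "R = (\<lambda>i tr.
    (\<Sum>(e, k, s)\<leftarrow>filter (\<lambda>(e, k, s). is_update e) tr. k) = (\<Sum>j = i..<length qs. ks j) \<and>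
    length (filter (\<lambda>(e, k, s). is_update e) tr) = length qs - i \<and>
    (\<forall>j<length tr. \<forall>u k (s :: state). tr ! j = (Mate u, k, s) \<longrightarrow> answer n s =
       mate (edges_of n (arr (st (i + length (updates (map fst (take j tr))))) ''mt'')) u \<and> k \<le> 3))"
  have R_Nil: "R (length qs) []" by (simp add: R_def)
  have R_Update: "R i ((Update q, ks i, s') # tr)" if "R (Suc i) tr" "i < length qs" for i q s' tr
    unfolding R_def
  proof (intro conjI)
    show "\<forall>j<length ((Update q, ks i, s') # tr). \<forall>u k s.
        ((Update q, ks i, s') # tr) ! j = (Mate u, k, s) \<longrightarrow> answer n s =
        mate (edges_of n (arr (st (i + length (updates (map fst (take j ((Update q, ks i, s') # tr))))))
          ''mt'')) u \<and> k \<le> 3"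
      using that(1) unfolding R_def by (intro allI impI; case_tac j) simp_all
  qed (use that in \<open>simp_all add: R_def sum.atLeast_Suc_lessThan\<close>)
  have R_Mate: "R i ((Mate v, k, s') # tr)"
    if "R i tr" "answer n s' = mate (edges_of n (arr (st i) ''mt'')) v" "k \<le> 3" for i k v s' tr
    unfolding R_def
  proof (intro conjI)
    show "\<forall>j<length ((Mate v, k, s') # tr). \<forall>u l s.
        ((Mate v, k, s') # tr) ! j = (Mate u, l, s) \<longrightarrow> answer n s =
        mate (edges_of n (arr (st (i + length (updates (map fst (take j ((Mate v, k, s') # tr))))))
          ''mt'')) u \<and> l \<le> 3"
      using that unfolding R_def by (intro allI impI; case_tac j) simp_all
  qed (use that in \<open>simp_all add: R_def\<close>)
  have "\<exists>tr. run_events W lookahead_matching m s es tr \<and> R i tr"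
    using es s
  proof (induction es arbitrary: i s)
    case Nil
    then have "i = length qs" by simp
    then show ?case using R_Nil by (auto intro: run_events.Done)
  next
    case (Cons ev es)
    show ?case
    proof (cases ev)
      case (Update q)
      with Cons.prems have i: "i < length qs"
        by (metis drop_all leI list.distinct(1) updates.simps(2))
      with Cons.prems(1) Update have up: "q = qs ! i" "updates es = drop (Suc i) qs"
        by (simp_all add: Cons_nth_drop_Suc[symmetric])
      have e: "exec W (take m (q # updates es)) (update_prog lookahead_matching) s (ks i) (st (Suc i))"
        using exec_update_cong[OF st[OF i] Cons.prems(4)] Cons.prems(1) Update by simp
      obtain tr where tr: "run_events W lookahead_matching m (st (Suc i)) es tr" "R (Suc i) tr"
        using Cons.IH[OF up(2) _ _ refl] i Cons.prems(3) by auto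
      have "run_events W lookahead_matching m s (ev # es) ((ev, ks i, st (Suc i)) # tr)"
        unfolding Update using e tr(1) by (rule run_events.Update)
      with R_Update[OF tr(2) i] show ?thesis unfolding Update by blast
    next
      case (Mate u)
      let ?s' = "set_reg ''mate'' (arr s ''mt'' u) (set_reg ''u'' u s)"
      have arr: "arr s = arr (st i)"
        using arg_cong[OF Cons.prems(4), of arr] by simp
      have u: "u < n" using Cons.prems(3) Mate by simp
      have mt: "mates n (G i) (arr s ''mt'')" using G Cons.prems(2) arr by simp
      then have "arr s ''mt'' u < W" using matesD(1)[OF mt u] n by simp
      then have e: "exec W (take m (updates es)) (query_prog lookahead_matching) (set_reg ''u'' u s) 3 ?s'"
        using exec.Assign[of "take m (updates es)" "set_reg ''u'' u s" "Cell ''mt'' (Reg ''u'')" W "''mate''"]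
        by (simp add: lookahead_matching_def eval_nat_numeral)
      have "set_reg ''mate'' 0 (set_reg ''u'' 0 ?s') = set_reg ''mate'' 0 (set_reg ''u'' 0 s)"
        by (simp add: set_reg_def fun_upd_twist)
      then obtain tr where tr: "run_events W lookahead_matching m ?s' es tr" "R i tr"
        using Cons.IH[of i ?s'] Cons.prems Mate by auto
      have "run_events W lookahead_matching m s (ev # es) ((ev, 3, ?s') # tr)"
        unfolding Mate using e tr(1) by (rule run_events.Mate)
      moreover have "answer n ?s' = mate (edges_of n (arr (st i) ''mt'')) u"
        using mate_edges_of[OF mt u] arr by (simp add: answer_def)
      ultimately show ?thesis
        using R_Mate[OF tr(2), of ?s' u 3] unfolding Mate by auto
    qed
  qed
  then show ?thesis by (simp add: R_def)
qed


section \<open>Choice of the constants and conclusion\<close>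

lemma word_bound_4: "n > 0 \<Longrightarrow> 2 * (n * n) + n + 2 < word_bound 4 n"
proof -
  assume "n > 0"
  have "9 \<le> (n + 2) * (n + 2)" using mult_le_mono[of 3 "n + 2" 3 "n + 2"] \<open>n > 0\<close> by simp
  then have "9 * ((n + 2) * (n + 2)) \<le> (n + 2) * (n + 2) * ((n + 2) * (n + 2))"
    by (rule mult_right_mono) simp
  then have "9 * ((n + 2) * (n + 2)) \<le> word_bound 4 n"
    unfolding word_bound_def by (simp only: power4_eq_xxxx mult.assoc)
  then show ?thesis by (simp add: algebra_simps)
qed

lemma le_log_factor:
  assumes "2 ^ L \<le> max 1 m"
  shows "real L \<le> log_factor m" "1 \<le> log_factor m"
proof -
  show "1 \<le> log_factor m" by (simp add: log_factor_def)
  show "real L \<le> log_factor m"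
  proof (cases "m = 0")
    case True
    with assms have "2 ^ L \<le> (1::nat)" by simp
    moreover have "L < 2 ^ L" by (rule less_exp)
    ultimately have "L = 0" by linarith
    then show ?thesis by (simp add: log_factor_def)
  next
    case False
    then have "(2::nat) ^ L \<le> m" using assms by (simp add: max_def split: if_splits)
    then have "(2::real) ^ L \<le> real m" by (metis of_nat_le_iff of_nat_numeral of_nat_power)
    then have "real L \<le> log 2 (real m)" by (intro le_log_of_power) simp_all
    then show ?thesis by (simp add: log_factor_def)
  qed
qed

theorem theorem1:
  shows "\<exists>(A :: algorithm) (b :: nat) (C :: real).
    \<forall>(n :: nat) (qs :: update list) (s0 :: state).
      n > 0 \<longrightarrow> (\<forall>q \<in> set qs. valid_update n q) \<longrightarrow> within_words (word_bound b n) s0 \<longrightarrow>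
      (let W = word_bound b n; m = max_edges qs in
       \<exists>k0 s1 M.
         run_init W A n m s0 k0 s1 \<and>
         real k0 \<le> C * ((real n)\<^sup>2 * log_factor m) \<and>
         (\<forall>i \<le> length qs. maximal_matching (graph_after (take i qs)) (M i)) \<and>
         (\<forall>es. updates es = qs \<longrightarrow> (\<forall>u. Mate u \<in> set es \<longrightarrow> u < n) \<longrightarrow>
            (\<exists>tr. run_events W A m s1 es tr \<and>
                  amortized_update_cost tr \<le> C * log_factor m \<and>
                  queries_ok n M C tr)))"
\<comment> \<open>16000 is 4000 per unit of charge, doubled for an incomplete last batch and doubled
  again for \<open>L + 1 <= 2 * log_factor m\<close>; it also dominates the setup constant 480 and
  the query cost 3. Words below \<open>(n + 2)^4\<close> hold all edge codes and list
  positions.\<close>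
proof (intro exI[of _ lookahead_matching] exI[of _ "4 :: nat"] exI[of _ "16000 :: real"] allI impI,
    unfold Let_def)
  fix n :: nat and qs :: "update list" and s0 :: state
  assume n: "n > 0" and valid: "\<forall>q \<in> set qs. valid_update n q"
  let ?W = "word_bound 4 n" and ?m = "max_edges qs" and ?A = lookahead_matching
  obtain L where L: "2 ^ L \<le> max 1 ?m" "?m < 2 * 2 ^ L"
  proof -
    obtain L where "2 ^ L \<le> max 1 ?m" "max 1 ?m < 2 ^ (L + 1)"
      using ex_power_ivl1[of 2 "max 1 ?m"] by auto
    then show ?thesis by (intro that[of L]) simp_all
  qed
  interpret lookahead_run n ?m L ?W qs
    using n valid L word_bound_4[OF n] by unfold_locales simp_all
  note lf = le_log_factor[OF L(1)]
  have "?m < ?W" using W' by simp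
  then obtain k0 s1 where init: "run_init ?W ?A n ?m s0 k0 s1"
    and k0: "k0 \<le> 60 * (n * n) + 60 * n + 60 * L + 300"
    and s1: "reg s1 ''n'' = n" "reg s1 ''m'' = ?m" "reg s1 ''K'' = 2 ^ L" "reg s1 ''p'' = 0"
      "reg s1 ''len'' = 0" "\<forall>e<n * n. arr s1 ''P'' e = 0" "\<forall>u<n. arr s1 ''mt'' u = n"
    using exec_init[OF W'(2,1,6) L, of s0] by blast
  have "real k0 \<le> 16000 * ((real n)\<^sup>2 * log_factor ?m)"
  proof -
    have nn: "1 \<le> (real n)\<^sup>2" "real n \<le> (real n)\<^sup>2"
      using n power_increasing[of 1 2 "real n"] by (simp_all add: one_le_power)
    have "real k0 \<le> real (60 * (n * n) + 60 * n + 60 * L + 300)" using k0 of_nat_mono by blast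
    also have "\<dots> = 60 * (real n)\<^sup>2 + 60 * real n + 60 * real L + 300"
      by (simp add: power2_eq_square)
    also have "\<dots> \<le> 420 * (real n)\<^sup>2 + 60 * real L" using nn by linarith
    also have "\<dots> \<le> 420 * ((real n)\<^sup>2 * log_factor ?m) + 60 * ((real n)\<^sup>2 * log_factor ?m)"
    proof -
      have "(real n)\<^sup>2 * 1 \<le> (real n)\<^sup>2 * log_factor ?m"
        using lf by (intro mult_left_mono) simp_all
      moreover have "1 * real L \<le> (real n)\<^sup>2 * log_factor ?m"
        using nn lf by (intro mult_mono) simp_all
      ultimately show ?thesis by linarith
    qed
    also have "\<dots> \<le> 16000 * ((real n)\<^sup>2 * log_factor ?m)" using lf by simp
    finally show ?thesis .
  qed
  define P where "P = (\<lambda>i s. (i \<le> length qs \<longrightarrow> invariant i s) \<and> (i = 0 \<longrightarrow> s = s1))"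
  define R where "R = (\<lambda>i s s'. i < length qs \<longrightarrow> (\<exists>k j. exec ?W (take ?m (drop i qs)) (update_prog ?A) s k s' \<and>
      j \<le> L \<and> 2 ^ j dvd i \<and> k \<le> 4000 * 2 ^ j))"
  \<comment> \<open>The states are chosen along the updates alone, because the matchings
    \<open>M\<close> must be named before the events \<open>es\<close>. Beyond the end of the stream
    both conditions hold trivially.\<close>
  have "\<exists>st. \<forall>i. P i (st i) \<and> R i (st i) (st (Suc i))"
  proof (rule dependent_nat_choice)
    show "\<exists>s. P 0 s" using invariant_0[OF s1] by (auto simp: P_def)
    show "\<exists>s'. P (Suc i) s' \<and> R i s s'" if "P i s" for i s
    proof (cases "i < length qs")
      case True
      then have "invariant i s" using that by (simp add: P_def)
      from exec_update[OF this True] show ?thesis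
        using True by (auto simp: P_def R_def)
    next
      case False
      then show ?thesis by (auto simp: P_def R_def)
    qed
  qed
  then obtain st where P: "\<And>i. P i (st i)" and R: "\<And>i. R i (st i) (st (Suc i))" by blast
  have st0: "st 0 = s1" and inv: "\<And>i. i \<le> length qs \<Longrightarrow> invariant i (st i)"
    using P by (auto simp: P_def)
  have "\<forall>i. \<exists>k. i < length qs \<longrightarrow>
      exec ?W (take ?m (drop i qs)) (update_prog ?A) (st i) k (st (Suc i)) \<and>
      (\<exists>j\<le>L. 2 ^ j dvd i \<and> k \<le> 4000 * 2 ^ j)"
    using R unfolding R_def by meson
  then obtain ks where ks: "\<And>i. i < length qs \<Longrightarrow>
      exec ?W (take ?m (drop i qs)) (update_prog ?A) (st i) (ks i) (st (Suc i)) \<and>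
      (\<exists>j\<le>L. 2 ^ j dvd i \<and> ks i \<le> 4000 * 2 ^ j)"
    by metis
  define M where "M = (\<lambda>i. edges_of n (arr (st i) ''mt''))"
  have mates: "mates n (graph i) (arr (st i) ''mt'')" if "i \<le> length qs" for i
    using inv[OF that] by (simp add: invariant_def base_inv_def)
  have max: "\<forall>i \<le> length qs. maximal_matching (graph_after (take i qs)) (M i)"
  proof (intro allI impI)
    fix i assume i: "i \<le> length qs"
    have "covers n (graph i) (arr (st i) ''mt'') {}"
      using inv[OF i] by (simp add: invariant_def base_inv_def)
    from maximal_matching_edges_of[OF simple_graph[OF i] mates[OF i] this]
    show "maximal_matching (graph_after (take i qs)) (M i)" by (simp add: M_def graph_def)
  qed
  have total: "real (\<Sum>i<length qs. ks i) / real (length qs) \<le> 16000 * log_factor ?m"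
  proof (cases "length qs = 0")
    case True
    then show ?thesis using lf by simp
  next
    case False
    let ?t = "length qs"
    \<comment> \<open>Since m is at most the number of updates, the extra \<open>2^L\<close> in the
      level sum is absorbed by \<open>?t\<close>.\<close>
    have "max 1 ?m \<le> ?t" using m_le_length False by (simp add: Suc_le_eq)
    with L(1) have "2 ^ L \<le> ?t" by (rule order_trans)
    have "(\<Sum>i<?t. ks i) \<le> 4000 * (Suc L * (?t + 2 ^ L))"
      by (rule sum_levels_le) (use ks in blast)
    also have "\<dots> \<le> 4000 * (Suc L * (?t + ?t))"
      using \<open>2 ^ L \<le> ?t\<close> by (intro mult_le_mono2 add_left_mono)
    finally have "real (\<Sum>i<?t. ks i) \<le> real (4000 * (Suc L * (?t + ?t)))"
      using of_nat_mono by blast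
    also have "\<dots> = 8000 * (real L + 1) * real ?t" by (simp add: algebra_simps)
    also have "\<dots> \<le> 16000 * log_factor ?m * real ?t"
      using lf by (intro mult_right_mono) simp_all
    finally show ?thesis using False by (simp add: divide_le_eq)
  qed
  have "\<exists>tr. run_events ?W ?A ?m s1 es tr \<and>
      amortized_update_cost tr \<le> 16000 * log_factor ?m \<and> queries_ok n M 16000 tr"
    if es: "updates es = qs" "\<forall>u. Mate u \<in> set es \<longrightarrow> u < n" for es
  proof -
    obtain tr where tr: "run_events ?W ?A ?m s1 es tr"
      "(\<Sum>(e, k, s)\<leftarrow>filter (\<lambda>(e, k, s). is_update e) tr. k) = (\<Sum>j = 0..<length qs. ks j)"
      "length (filter (\<lambda>(e, k, s). is_update e) tr) = length qs - 0"
      "\<forall>j<length tr. \<forall>u k s. tr ! j = (Mate u, k, s) \<longrightarrow> answer n s =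
         mate (edges_of n (arr (st (0 + length (updates (map fst (take j tr))))) ''mt'')) u \<and> k \<le> 3"
      using run_events_lookahead[of qs ?W ?m st ks n graph es 0 s1] ks mates W' es st0 by auto
    have "amortized_update_cost tr \<le> 16000 * log_factor ?m"
      using total tr(2,3) by (simp add: amortized_update_cost_def lessThan_atLeast0)
    moreover have "queries_ok n M 16000 tr"
      unfolding queries_ok_def M_def using tr(4) by fastforce
    ultimately show ?thesis using tr(1) by blast
  qed
  then show "\<exists>k0 s1 M. run_init ?W ?A n ?m s0 k0 s1 \<and>
      real k0 \<le> 16000 * ((real n)\<^sup>2 * log_factor ?m) \<and>
      (\<forall>i \<le> length qs. maximal_matching (graph_after (take i qs)) (M i)) \<and>
      (\<forall>es. updates es = qs \<longrightarrow> (\<forall>u. Mate u \<in> set es \<longrightarrow> u < n) \<longrightarrow>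
         (\<exists>tr. run_events ?W ?A ?m s1 es tr \<and>
               amortized_update_cost tr \<le> 16000 * log_factor ?m \<and> queries_ok n M 16000 tr))"
    using init \<open>real k0 \<le> _\<close> max by (intro exI[of _ k0] exI[of _ s1] exI[of _ M]) blast
qed

end
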